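(* Let $\mu \in \Lambda^{\mathrm{bal}}$ and define $$k \coloneqq \max\left(\{0\} \cup \left\{ m \in \mathbb{Z}_{>0} \;\middle|\; p^m \le \tfrac{|\mu|}{2},\ \mu \in B\bigl(p^m\Lambda^{\mathrm{bal}}_{\mathrm{odd}},\, p^m\bigr)\right\}\right).$$ (1) Suppose $k=0$. (a) If $\mu \in \Lambda^{\mathrm{bal}}_{\mathrm{odd}}$, then $\Delta(\mu)=1$ and $\exp(\mathcal{A},\mu) = \left(\frac{|\mu|-1}{2},\ \frac{|\mu|+1}{2}\right)$. (b) If $\mu \in \Lambda^{\mathrm{bal}}_{\mathrm{even}}$, then $\Delta(\mu)=0$ and $\exp(\mathcal{A},\mu) = \left(\frac{|\mu|}{2},\ \frac{|\mu|}{2}\right)$. (2) Suppose $k>0$ and write $\mu = p^k\alpha + \beta$ with $\alpha \in \Lambda$ and $0 \le \beta_i < p^k$ for $i=1,2,3$. Indices $i, i+1, i+2$ are taken modulo $3$ in $\{1,2,3\}$. (c) If $\alpha \in \Lambda_{\mathrm{even}}$ and $\beta_i > \frac{|\beta|}{2}$ for some $i \in \{1,2,3\}$, then $\Delta(\mu) = \beta_i - \beta_{i+1} - \beta_{i+2}$ and $\exp(\mathcal{A},\mu) = \left(\frac{|\alpha|}{2}p^k + \beta_{i+1}+\beta_{i+2},\ \frac{|\alpha|}{2}p^k + \beta_i\right)$. (d) If $\alpha \in \Lambda_{\mathrm{even}}$ and $\frac{|\beta|}{2} > p^k$, then $\Delta(\mu) = |\beta| - 2p^k$ and $\exp(\mathcal{A},\mu)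 = \left(\frac{|\alpha|}{2}p^k + p^k,\ \frac{|\alpha|}{2}p^k + |\beta| - p^k\right)$. (e) If $\alpha \in \Lambda_{\mathrm{odd}}$ and $p^k - \beta_i > \frac{|p^k\mathbf{1} - \beta|}{2}$ for some $i\in\{1,2,3\}$, where $\mathbf{1}=(1,1,1)$, then $\Delta(\mu) = -\beta_i + \beta_{i+1} + \beta_{i+2} - p^k$ and $\exp(\mathcal{A},\mu) = \left(\frac{|\alpha|+1}{2}p^k + \beta_i,\ \frac{|\alpha|-1}{2}p^k + \beta_{i+1}+\beta_{i+2}\right)$. (f) If $\alpha \in \Lambda_{\mathrm{odd}}$ and $\frac{|p^k\mathbf{1}-\beta|}{2} > p^k$, then $\Delta(\mu) = p^k - |\beta|$ and $\exp(\mathcal{A},\mu) = \left(\frac{|\alpha|-1}{2}p^k + |\beta|,\ \frac{|\alpha|+1}{2}p^k\right)$.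
   Context: Let $p$ be a prime, $\mathbb{F}=\mathbb{F}_p$, $S=\mathbb{F}[x,y]$ and $\mathrm{Der}_S = S\partial_x \oplus S\partial_y$. Let $\mathcal{A}=\{H_1,H_2,H_3\}$ be the arrangement of lines in $\mathbb{F}^2$ with $H_1=\ker x$, $H_2 = \ker y$, $H_3 = \ker(x+y)$, and set $\alpha_1 = x$, $\alpha_2=y$, $\alpha_3 = x+y$. A multiplicity is an element $\mu=(\mu_1,\mu_2,\mu_3)$ of $\Lambda \coloneqq \mathbb{Z}_{\ge 0}^3$; write $|z| = |z_1|+|z_2|+|z_3|$ for $z \in \mathbb{Z}^3$. Let $D(\mathcal{A},\mu) = \{\theta \in \mathrm{Der}_S : \theta(\alpha_i) \in \alpha_i^{\mu_i}S \text{ for } i=1,2,3\}$. This $S$-module is free of rank $2$ with a basis $\{\theta,\theta'\}$ of homogeneous derivations (each of the form $f\partial_x+g\partial_y$ with $f,g$ homogeneous of a common degree, its degree); the pair of degrees $\exp(\mathcal{A},\mu)$ (the exponents) is uniquely determined up to order and its entries sum to $|\mu|$. Define $\Delta(\mu)\ge 0$ as the absolute difference of the two exponents. $\mu$ is balanced if $\mu_i \le |\mu|/2$ for all $i$; $\Lambda^{\mathrm{bal}}$ is the set of balanced multiplicities. $\Lambda_{\mathrm{odd}} = \{\mu\in\Lambda : |\mu| \text{ odd}\}$, $\Lambda_{\mathrm{even}} = \{\mu\in\Lambda : |\mu| \text{ even}\}$, $\Lambda^{\mathrm{bal}}_{\mathrm{odd}} = \Lambda^{\mathrm{bal}}\cap\Lambda_{\mathrm{odd}}$,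 $\Lambda^{\mathrm{bal}}_{\mathrm{even}} = \Lambda^{\mathrm{bal}}\cap\Lambda_{\mathrm{even}}$. For $\zeta \in \Lambda$ and $r\in\mathbb{Z}_{>0}$, $B(\zeta,r) = \{\mu \in \Lambda : |\mu - \zeta| < r\}$, and for $T\subseteq \Lambda$, $B(T,r) = \bigcup_{\zeta\in T} B(\zeta,r)$; also $cT = \{c\nu : \nu \in T\}$. *)

theory Defs
  imports "HOL-Analysis.Analysis" "HOL-Computational_Algebra.Polynomial"
begin

section \<open>Multiplicities\<close>

text \<open>
  Indices are elements of the numeral type \<^typ>\<open>3\<close>, whose arithmetic is modulo 3, so that
  \<open>i + 1\<close> and \<open>i + 2\<close> are the cyclic successors of \<open>i\<close> and the index \<open>3\<close> is the element \<open>0\<close>.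
  The set of all multiplicities is the type \<^typ>\<open>nat^3\<close>.
\<close>

type_synonym multiplicity = "nat^3"

definition l1 :: "int^3 \<Rightarrow> int" where
  "l1 z = (\<Sum>i\<in>UNIV. \<bar>z $ i\<bar>)"

text \<open>The same quantity on multiplicities, where the entries are nonnegative.\<close>

definition wt :: "multiplicity \<Rightarrow> nat" where
  "wt \<mu> = (\<Sum>i\<in>UNIV. \<mu> $ i)"

definition Lambda_bal :: "multiplicity set" where
  "Lambda_bal = {\<mu>. \<forall>i. real (\<mu> $ i) \<le> real (wt \<mu>) / 2}"

definition Lambda_odd :: "multiplicity set" where
  "Lambda_odd = {\<mu>. odd (wt \<mu>)}"

definition Lambda_even :: "multiplicity set" where
  "Lambda_even = {\<mu>. even (wt \<mu>)}"

definition Lambda_bal_odd :: "multiplicity set" where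
  "Lambda_bal_odd = Lambda_bal \<inter> Lambda_odd"

definition Lambda_bal_even :: "multiplicity set" where
  "Lambda_bal_even = Lambda_bal \<inter> Lambda_even"

definition l1_ball :: "multiplicity \<Rightarrow> nat \<Rightarrow> multiplicity set" where
  "l1_ball \<zeta> r = {\<mu>. l1 (\<chi> i. int (\<mu> $ i) - int (\<zeta> $ i)) < int r}"

definition l1_nbhd :: "multiplicity set \<Rightarrow> nat \<Rightarrow> multiplicity set" where
  "l1_nbhd T r = (\<Union>\<zeta>\<in>T. l1_ball \<zeta> r)"

definition kmax :: "nat \<Rightarrow> multiplicity \<Rightarrow> nat" where
  "kmax p \<mu> = Max ({0} \<union> {m. 0 < m \<and> real (p ^ m) \<le> real (wt \<mu>) / 2 \<and>
                              \<mu> \<in> l1_nbhd ((\<lambda>\<nu>. p ^ m *s \<nu>) ` Lambda_bal_odd) (p ^ m)})"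


section \<open>Polynomials in two variables and their derivations\<close>

text \<open>
  The ring \<open>S = F[x,y]\<close> is \<^typ>\<open>'a poly poly\<close>, read as \<open>F[x][y]\<close>: the inner variable is \<open>x\<close>, the
  outer one is \<open>y\<close>, and the coefficient of \<open>x\<^sup>i y\<^sup>j\<close> in \<open>f\<close> is \<open>coeff (coeff f j) i\<close>.
\<close>

definition var_x :: "'a::field poly poly" where
  "var_x = [:[:0, 1:]:]"

definition var_y :: "'a::field poly poly" where
  "var_y = [:0, 1:]"

definition partial_x :: "'a::field poly poly \<Rightarrow> 'a poly poly" where
  "partial_x f = map_poly pderiv f"

definition partial_y :: "'a::field poly poly \<Rightarrow> 'a poly poly" where
  "partial_y f = pderiv f"

definition homogeneous :: "nat \<Rightarrow> 'a::field poly poly \<Rightarrow> bool" where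
  "homogeneous d f \<longleftrightarrow> (\<forall>i j. coeff (coeff f j) i \<noteq> 0 \<longrightarrow> i + j = d)"

text \<open>The pair \<open>(f, g)\<close> stands for the derivation \<open>f \<partial>\<^sub>x + g \<partial>\<^sub>y\<close>.\<close>

type_synonym 'a der = "'a poly poly \<times> 'a poly poly"

definition der_apply :: "'a::field der \<Rightarrow> 'a poly poly \<Rightarrow> 'a poly poly" where
  "der_apply \<theta> h = fst \<theta> * partial_x h + snd \<theta> * partial_y h"

definition der_scale :: "'a::field poly poly \<Rightarrow> 'a der \<Rightarrow> 'a der" where
  "der_scale s \<theta> = (s * fst \<theta>, s * snd \<theta>)"

global_interpretation der: module der_scale
  by standard (auto simp: der_scale_def algebra_simps)

definition homogeneous_der :: "nat \<Rightarrow> 'a::field der \<Rightarrow> bool" where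
  "homogeneous_der d \<theta> \<longleftrightarrow> homogeneous d (fst \<theta>) \<and> homogeneous d (snd \<theta>)"


section \<open>The arrangement, its logarithmic derivations and its exponents\<close>

definition alpha_form :: "3 \<Rightarrow> 'a::field poly poly" where
  "alpha_form i = (if i = 1 then var_x else if i = 2 then var_y else var_x + var_y)"

definition log_der :: "multiplicity \<Rightarrow> 'a::field der set" where
  "log_der \<mu> = {\<theta>. \<forall>i. alpha_form i ^ (\<mu> $ i) dvd der_apply \<theta> (alpha_form i)}"

definition homogeneous_basis ::
    "multiplicity \<Rightarrow> 'a::field der \<Rightarrow> 'a der \<Rightarrow> nat \<Rightarrow> nat \<Rightarrow> bool" where
  "homogeneous_basis \<mu> \<theta> \<theta>' d d' \<longleftrightarrow>
     \<theta> \<noteq> \<theta>' \<and> der.independent {\<theta>, \<theta>'} \<and> der.span {\<theta>, \<theta>'} = log_der \<mu> \<and>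
     homogeneous_der d \<theta> \<and> homogeneous_der d' \<theta>'"

text \<open>
  The exponents form a pair determined up to order, hence a multiset. Every homogeneous
  basis yields the same multiset, and one exists, so the description below is proper.
  The type argument is the ground field.
\<close>

definition exponents :: "'a::field itself \<Rightarrow> multiplicity \<Rightarrow> nat multiset" where
  "exponents F \<mu> =
     (THE M. \<exists>(\<theta> :: 'a der) \<theta>' d d'. homogeneous_basis \<mu> \<theta> \<theta>' d d' \<and> M = {#d, d'#})"

definition Delta :: "'a::field itself \<Rightarrow> multiplicity \<Rightarrow> int" where
  "Delta F \<mu> = (THE \<delta>. \<exists>d d'. exponents F \<mu> = {#d, d'#} \<and> \<delta> = \<bar>int d - int d'\<bar>)"

end

theory Submission
  imports Defs
begin

text \<open>
  Let \<open>\<delta>(\<mu>) = \<Delta>(\<mu>)\<close>, that is \<open>|\<mu>|\<close> minus twice the least degree of a nonzero homogeneous element of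
  \<open>D(A, \<mu>)\<close>. A logarithmic derivation is a syzygy of \<open>x\<^sup>a, y\<^sup>b, (x + y)\<^sup>c\<close>, so \<open>\<delta>\<close> is Han's syzygy gap.
  Multiplying derivations by the forms \<open>\<alpha>\<^sub>i\<close> shows that \<open>\<delta>\<close> is 1-Lipschitz for the \<open>l\<^sub>1\<close> distance, and
  the Frobenius map gives \<open>p \<delta>(\<mu>) \<le> \<delta>(p \<mu>)\<close>; since \<open>\<delta>(\<nu>) \<ge> 1\<close> for odd \<open>|\<nu>|\<close>, this yields the lower
  bound \<open>\<delta>(\<mu>) \<ge> p\<^sup>k - |\<mu> - p\<^sup>k \<nu>|\<close>. Conversely, climb from a balanced \<open>\<mu>\<close> with \<open>\<delta>(\<mu>) > 0\<close> to a peak of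
  \<open>\<delta>\<close>. Following Monsky, Mason's Wronskian argument shows that a peak of height at least 2 is \<open>p\<close> times
  a peak, so every peak is \<open>p\<^sup>m \<nu>\<close> with \<open>\<nu>\<close> balanced and odd and has height \<open>p\<^sup>m\<close>. Hence
  \<open>\<delta>(\<mu>) = p\<^sup>m - |\<mu> - p\<^sup>m \<nu>|\<close>, and a parity argument shows that the largest admissible \<open>m\<close> may be taken.
\<close>

section \<open>Tents on the lattice of multiplicities\<close>

text \<open>The l1 distance underlying \<open>l1_ball\<close>, taken in the integers because
  subtraction on \<open>nat\<close> truncates.\<close>

definition sep :: "multiplicity \<Rightarrow> multiplicity \<Rightarrow> int" where
  "sep s t = l1 (\<chi> i. int (s $ i) - int (t $ i))"

lemma sep_3: "sep s t = \<bar>int (s $ 1) - int (t $ 1)\<bar> + \<bar>int (s $ 2) - int (t $ 2)\<bar> + \<bar>int (s $ 3) - int (t $ 3)\<bar>"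
  by (simp add: sep_def l1_def sum_3)

lemma wt_3: "wt t = t $ 1 + t $ 2 + t $ 3"
  by (simp add: wt_def sum_3)

lemma sep_nonneg: "sep s t \<ge> 0"
  by (simp add: sep_3)

lemma sep_commute: "sep s t = sep t s"
  by (simp add: sep_3 abs_minus_commute)

lemma sep_triangle: "sep s u \<le> sep s t + sep t u"
  by (simp add: sep_3)

lemma sep_scale: "sep (n *s s) (n *s t) = int n * sep s t"
proof -
  have *: "\<bar>int n * x - int n * y\<bar> = int n * \<bar>x - y\<bar>" for x y
    by (simp add: abs_mult flip: right_diff_distrib)
  show ?thesis
    by (simp add: sep_3 * distrib_left)
qed

lemma scale_one: "(1::nat) *s t = t"
  by (simp add: vec_eq_iff)

lemma wt_scale: "wt (n *s t) = n * wt t"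
  by (simp add: wt_3 algebra_simps)

text \<open>Absolute values do not change parity. Consequently neighbouring points have weights, and
  later gaps, of opposite parity.\<close>

lemma even_sep_iff: "even (sep s t) \<longleftrightarrow> even (wt s + wt t)"
  by (simp add: sep_3 wt_3) presburger

lemma Lambda_bal_iff: "t \<in> Lambda_bal \<longleftrightarrow> (\<forall>i. 2 * t $ i \<le> wt t)"
proof -
  have "real (t $ i) \<le> real (wt t) / 2 \<longleftrightarrow> real (2 * t $ i) \<le> real (wt t)" for i
    by (simp add: mult.commute)
  then show ?thesis
    unfolding Lambda_bal_def by (simp only: of_nat_le_iff mem_Collect_eq)
qed

lemma Lambda_bal_scale_iff: "n > 0 \<Longrightarrow> n *s t \<in> Lambda_bal \<longleftrightarrow> t \<in> Lambda_bal"
  by (simp add: Lambda_bal_iff wt_scale mult.left_commute)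

lemma mem_l1_nbhd_scale:
  "\<mu> \<in> l1_nbhd ((\<lambda>\<nu>. q *s \<nu>) ` T) q \<longleftrightarrow> (\<exists>\<nu>\<in>T. sep \<mu> (q *s \<nu>) < int q)"
  by (simp add: l1_nbhd_def l1_ball_def sep_def)

text \<open>Centres of different scales never lie at distance exactly the larger radius, for parity
  reasons; hence two of the balls are either disjoint or suitably nested.\<close>

lemma nested_tents:
  fixes p m k :: nat
  assumes "p > 0" "m \<le> k" "odd (wt \<nu>)" "odd (wt \<nu>')"
    and "sep \<mu> (p ^ k *s \<nu>) < int (p ^ k)" "sep \<mu> (p ^ m *s \<nu>') < int (p ^ m)"
  shows "int (p ^ m) - sep \<mu> (p ^ m *s \<nu>') \<le> int (p ^ k) - sep \<mu> (p ^ k *s \<nu>)"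
proof -
  \<comment> \<open>\<open>P\<close> is the ratio of the two radii and \<open>D\<close> the distance
    of the centres in units of \<open>p ^ m\<close>.\<close>
  define P where "P = p ^ (k - m)"
  define D where "D = sep \<nu>' (P *s \<nu>)"
  have pk: "p ^ k = p ^ m * P"
    using assms(2) by (simp add: P_def flip: power_add)
  have "p ^ k *s \<nu> = p ^ m *s (P *s \<nu>)"
    by (simp add: pk vec_eq_iff)
  then have centres: "sep (p ^ m *s \<nu>') (p ^ k *s \<nu>) = int (p ^ m) * D"
    by (simp only: sep_scale D_def)
  \<comment> \<open>Both weights are odd, so \<open>D\<close> and \<open>P\<close> have opposite
    parity, which excludes the borderline \<open>D = P\<close>.\<close>
  have "even D \<longleftrightarrow> even (wt \<nu>' + P * wt \<nu>)"
    by (simp add: D_def even_sep_iff wt_scale)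
  then have "even D \<longleftrightarrow> odd P"
    using assms(3,4) by simp
  then have "D \<noteq> int P"
    by auto
  \<comment> \<open>If \<open>D < P\<close>, the triangle inequality puts the smaller tent below the
    larger one. If \<open>D > P\<close>, the balls are disjoint and cannot both contain
    \<open>\<mu>\<close>.\<close>
  then consider "D \<le> int P - 1" | "D \<ge> int P + 1"
    by linarith
  then show ?thesis
  proof cases
    case 1
    then have "int (p ^ m) * D \<le> int (p ^ m) * (int P - 1)"
      by (intro mult_left_mono) auto
    then have "int (p ^ m) * D \<le> int (p ^ k) - int (p ^ m)"
      by (simp add: pk algebra_simps)
    then show ?thesis
      using sep_triangle[of \<mu> "p ^ k *s \<nu>" "p ^ m *s \<nu>'"] centres by linarith
  next
    case 2
    then have "int (p ^ m) * D \<ge> int (p ^ m) * (int P + 1)"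
      by (intro mult_left_mono) auto
    then have "int (p ^ m) * D \<ge> int (p ^ k) + int (p ^ m)"
      by (simp add: pk algebra_simps)
    then show ?thesis
      using sep_triangle[of "p ^ m *s \<nu>'" "p ^ k *s \<nu>" \<mu>] centres assms(5,6)
        sep_commute[of \<mu> "p ^ m *s \<nu>'"] by linarith
  qed
qed

text \<open>A balanced multiplicity of odd weight has weight at least 3, so the centre weighs at
  least \<open>3 * q\<close>, and moving by less than \<open>q\<close> leaves at least
  \<open>2 * q\<close>. This supplies the size condition in \<open>kmax\<close>.\<close>

lemma radius_le_half_wt:
  assumes "\<nu> \<in> Lambda_bal_odd" "sep \<mu> (q *s \<nu>) < int q"
  shows "2 * q \<le> wt \<mu>"
proof -
  have "odd (wt \<nu>)" "\<forall>i. 2 * \<nu> $ i \<le> wt \<nu>"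
    using assms(1) by (auto simp: Lambda_bal_odd_def Lambda_odd_def Lambda_bal_iff)
  then have "3 \<le> wt \<nu>"
    by (simp add: forall_3 wt_3) presburger
  then have "q * 3 \<le> q * wt \<nu>"
    by (intro mult_left_mono) auto
  moreover have "int (q * wt \<nu>) - int (wt \<mu>) \<le> sep \<mu> (q *s \<nu>)"
    by (simp add: sep_3 wt_3 distrib_left)
  ultimately show ?thesis
    using assms(2) by linarith
qed

text \<open>Since \<open>m < p ^ m\<close>, only finitely many exponents fit under the bound.
  Finiteness gives the \<open>Max\<close> in \<open>kmax\<close> its meaning; \<open>Q\<close>
  stands for membership in the neighbourhood.\<close>

lemma finite_radii:
  assumes "p \<ge> 2"
  shows "finite {m. 0 < m \<and> real (p ^ m) \<le> real n / 2 \<and> Q m}"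
proof (rule finite_subset)
  show "{m. 0 < m \<and> real (p ^ m) \<le> real n / 2 \<and> Q m} \<subseteq> {..n}"
  proof (clarsimp simp del: of_nat_power le_divide_eq_numeral1)
    fix m assume "real (p ^ m) \<le> real n / 2"
    then have "real (2 * p ^ m) \<le> real n"
      by simp
    then have "2 * p ^ m \<le> n"
      by (simp only: of_nat_le_iff)
    moreover have "m < p ^ m"
      using assms by (simp add: power_gt_expt)
    ultimately show "m \<le> n"
      by linarith
  qed
qed auto

lemma kmax_ge:
  assumes "p \<ge> 2" "\<nu> \<in> Lambda_bal_odd" "sep \<mu> (p ^ m *s \<nu>) < int (p ^ m)"
  shows "m \<le> kmax p \<mu>"
proof (cases "m = 0")
  case False
  have "2 * p ^ m \<le> wt \<mu>"
    using radius_le_half_wt[OF assms(2,3)] .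
  then have "real (2 * p ^ m) \<le> real (wt \<mu>)"
    by (simp only: of_nat_le_iff)
  then have "real (p ^ m) \<le> real (wt \<mu>) / 2"
    by simp
  then show ?thesis
    unfolding kmax_def using False assms finite_radii[OF assms(1)]
    by (intro Max_ge) (auto simp: mem_l1_nbhd_scale)
qed simp

text \<open>The properties of \<open>Delta\<close> on which the combinatorial half rests.
  \<open>gap_le\<close> says that the smaller exponent is at least every entry;
  \<open>gap_peak\<close> is the descent step that comes from the Wronskian.\<close>

locale syzygy_gap =
  fixes p :: nat and \<delta> :: "multiplicity \<Rightarrow> int"
  assumes p_ge_2: "p \<ge> 2"
    and even_gap_iff: "even (\<delta> t) \<longleftrightarrow> even (wt t)"
    and gap_nonneg: "\<delta> t \<ge> 0"
    and gap_lipschitz: "\<delta> t \<le> \<delta> s + sep s t"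
    and gap_le: "t \<in> Lambda_bal \<Longrightarrow> \<delta> t \<le> int (wt t) - 2 * int (t $ i)"
    and gap_frobenius: "int p * \<delta> t \<le> \<delta> (p *s t)"
    and gap_peak: "(\<And>s. sep s t = 1 \<Longrightarrow> \<delta> s < \<delta> t) \<Longrightarrow> \<delta> t \<ge> 2 \<Longrightarrow>
                     \<exists>s. t = p *s s \<and> \<delta> t \<le> int p * \<delta> s"
begin

section \<open>Tents, peaks and climbing for an abstract gap function\<close>

lemma gap_power_frobenius: "int (p ^ k) * \<delta> t \<le> \<delta> (p ^ k *s t)"
proof (induction k)
  case (Suc k)
  have "int (p ^ Suc k) * \<delta> t = int p * (int (p ^ k) * \<delta> t)"
    by simp
  also have "\<dots> \<le> int p * \<delta> (p ^ k *s t)"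
    by (intro mult_left_mono Suc.IH) auto
  also have "\<dots> \<le> \<delta> (p *s (p ^ k *s t))"
    by (rule gap_frobenius)
  also have "p *s (p ^ k *s t) = p ^ Suc k *s t"
    by (simp add: vec_eq_iff)
  finally show ?case .
qed (simp add: scale_one flip: One_nat_def)

text \<open>Oddness forces \<open>\<delta> \<nu> \<ge> 1\<close>; the Frobenius bound lifts this to
  height \<open>p ^ k\<close> at \<open>p ^ k *s \<nu>\<close>, and from there the gap falls with
  slope at most one.\<close>

lemma gap_ge_tent:
  assumes "odd (wt \<nu>)"
  shows "int (p ^ k) - sep \<mu> (p ^ k *s \<nu>) \<le> \<delta> \<mu>"
proof -
  have "\<delta> \<nu> \<ge> 1"
    using gap_nonneg[of \<nu>] even_gap_iff[of \<nu>] assms by presburger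
  then have "int (p ^ k) * 1 \<le> int (p ^ k) * \<delta> \<nu>"
    by (intro mult_left_mono) auto
  then show ?thesis
    using gap_power_frobenius[of k \<nu>] gap_lipschitz[of "p ^ k *s \<nu>" \<mu>] by linarith
qed

text \<open>Induction on the weight. Height 1 means odd weight, which is the case
  \<open>m = 0\<close>. A higher peak is \<open>p *s s\<close> by \<open>gap_peak\<close>, and
  \<open>s\<close> turns out to be a peak again.\<close>

lemma peak_is_scaled_odd:
  assumes "\<And>s. sep s t = 1 \<Longrightarrow> \<delta> s < \<delta> t" "\<delta> t \<ge> 1" "t \<in> Lambda_bal"
  shows "\<exists>m. \<exists>\<nu>\<in>Lambda_bal_odd. t = p ^ m *s \<nu> \<and> \<delta> t = int (p ^ m)"
  using assms
proof (induction "wt t" arbitrary: t rule: less_induct)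
  case less
  show ?case
  proof (cases "\<delta> t = 1")
    case True
    then have "odd (wt t)"
      using even_gap_iff[of t] by simp
    then have "t \<in> Lambda_bal_odd"
      using less.prems(3) by (simp add: Lambda_bal_odd_def Lambda_odd_def)
    then show ?thesis
      using True by (intro exI[of _ 0] bexI[of _ t]) (auto simp: scale_one simp flip: One_nat_def)
  next
    case False
    then have "\<delta> t \<ge> 2"
      using less.prems(2) by linarith
    then obtain s where s: "t = p *s s" "\<delta> t \<le> int p * \<delta> s"
      using gap_peak[OF less.prems(1)] by blast
    then have gap_t: "\<delta> t = int p * \<delta> s"
      using gap_frobenius[of s] by simp
    have s_pos: "\<delta> s \<ge> 1"
    proof -
      have "int p * \<delta> s > 0"
        using less.prems(2) gap_t by linarith
      then show ?thesis
        by (simp add: zero_less_mult_iff)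
    qed
    have s_bal: "s \<in> Lambda_bal"
      using less.prems(3) p_ge_2 by (simp add: s(1) Lambda_bal_scale_iff)
    \<comment> \<open>At weight zero \<open>gap_le\<close> would give
      \<open>\<delta> s \<le> 0\<close>. Positive weight makes the induction descend.\<close>
    have "wt s > 0"
    proof (rule ccontr)
      assume "\<not> wt s > 0"
      then show False
        using gap_le[OF s_bal, of 1] s_pos by simp
    qed
    then have "wt s < wt t"
      using p_ge_2 by (simp add: s(1) wt_scale)
    \<comment> \<open>A neighbour \<open>r\<close> that is not lower than \<open>s\<close> is higher
      by parity, so the gap at \<open>p *s r\<close> exceeds that at \<open>t\<close> by at least
      \<open>p\<close>. Then a neighbour of \<open>t\<close> at distance \<open>p - 1\<close> from
      \<open>p *s r\<close> is higher than \<open>t\<close>.\<close>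
    moreover have "\<delta> r < \<delta> s" if r: "sep r s = 1" for r
    proof (rule ccontr)
      assume "\<not> \<delta> r < \<delta> s"
      moreover have "\<delta> r \<noteq> \<delta> s"
        using even_gap_iff[of r] even_gap_iff[of s] even_sep_iff[of r s] r by auto
      ultimately have "int p * \<delta> r \<ge> int p * (\<delta> s + 1)"
        by (intro mult_left_mono) auto
      then have pr: "\<delta> (p *s r) \<ge> \<delta> t + int p"
        using gap_frobenius[of r] gap_t by (simp add: algebra_simps)
      have "\<exists>q. sep q t = 1 \<and> sep q (p *s r) \<le> int p - 1"
      proof -
        \<comment> \<open>The unit step from \<open>s\<close> to \<open>r\<close>, applied at
          \<open>t\<close>: it leads towards \<open>p *s r\<close>. The cast by \<open>nat\<close>
          loses nothing because \<open>s\<close> lies below \<open>t\<close> in every entry.\<close>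
        define q :: multiplicity where "q = (\<chi> i. nat (int (t $ i) + (int (r $ i) - int (s $ i))))"
        obtain i where i: "\<bar>int (r $ i) - int (s $ i)\<bar> = 1" "\<And>j. j \<noteq> i \<Longrightarrow> r $ j = s $ j"
        proof -
          have "\<exists>i. \<bar>int (r $ i) - int (s $ i)\<bar> = 1 \<and> (\<forall>j. j \<noteq> i \<longrightarrow> r $ j = s $ j)"
          proof -
            have *: "\<bar>int (r $ 1) - int (s $ 1)\<bar> + \<bar>int (r $ 2) - int (s $ 2)\<bar> + \<bar>int (r $ 3) - int (s $ 3)\<bar> = 1"
              using r by (simp add: sep_3)
            then consider "r $ 1 = s $ 1" "r $ 2 = s $ 2" | "r $ 1 = s $ 1" "r $ 3 = s $ 3"
              | "r $ 2 = s $ 2" "r $ 3 = s $ 3"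
              by linarith
            then show ?thesis
              using * by cases (auto simp: forall_3 intro: exI[of _ 1] exI[of _ 2] exI[of _ 3])
          qed
          then show ?thesis using that by blast
        qed
        have qi: "int (q $ j) = int (t $ j) + (int (r $ j) - int (s $ j))" for j
        proof -
          have "s $ j \<le> t $ j"
            using p_ge_2 by (simp add: s(1))
          then show ?thesis by (simp add: q_def)
        qed
        have "sep q t = sep r s"
          by (simp add: sep_3 qi)
        moreover have "sep q (p *s r) = (int p - 1) * sep r s"
        proof -
          have "\<bar>int (q $ j) - int ((p *s r) $ j)\<bar> = (int p - 1) * \<bar>int (r $ j) - int (s $ j)\<bar>" for j
          proof -
            have "int (q $ j) - int ((p *s r) $ j) = - ((int p - 1) * (int (r $ j) - int (s $ j)))"
              by (simp add: qi s(1) algebra_simps)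
            then show ?thesis
              using p_ge_2 by (simp add: abs_mult)
          qed
          then show ?thesis
            by (simp add: sep_3 distrib_left)
        qed
        ultimately show ?thesis
          using r by auto
      qed
      then obtain q where q: "sep q t = 1" "sep q (p *s r) \<le> int p - 1"
        by blast
      then have "\<delta> q \<ge> \<delta> t + 1"
        using pr gap_lipschitz[of "p *s r" q] by linarith
      then show False
        using less.prems(1)[OF q(1)] by linarith
    qed
    ultimately obtain m \<nu> where \<nu>: "\<nu> \<in> Lambda_bal_odd" "s = p ^ m *s \<nu>" "\<delta> s = int (p ^ m)"
      using less.hyps[of s] s_pos s_bal by blast
    have "\<delta> t = int (p ^ Suc m)"
      by (simp add: gap_t \<nu>(3))
    moreover have "t = p ^ Suc m *s \<nu>"
      by (simp add: s(1) \<nu>(2) vec_eq_iff)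
    ultimately show ?thesis
      using \<nu>(1) by blast
  qed
qed

text \<open>Climbing from \<open>\<mu>\<close> as long as the gap increases ends at a peak: the bound \<open>\<delta>(c) \<le> |c| - 2 c\<^sub>i\<close>,
  summed over \<open>i\<close>, limits the length of the climb by \<open>|\<mu>| / 2\<close>.\<close>

lemma gap_is_tent:
  assumes "\<mu> \<in> Lambda_bal" "\<delta> \<mu> \<ge> 1"
  shows "\<exists>m. \<exists>\<nu>\<in>Lambda_bal_odd. \<delta> \<mu> = int (p ^ m) - sep \<mu> (p ^ m *s \<nu>)"
proof -
  \<comment> \<open>The balanced points at which the gap has grown from \<open>\<mu>\<close> as fast
    as the Lipschitz bound permits; \<open>c\<close> will be a farthest one.\<close>
  define Q where "Q c \<longleftrightarrow> c \<in> Lambda_bal \<and> \<delta> c = \<delta> \<mu> + sep \<mu> c" for c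
  have "Q \<mu>"
    using assms by (simp add: Q_def sep_3)
  moreover have "nat (sep \<mu> c) < Suc (wt \<mu>)" if "Q c" for c
  proof -
    have "\<delta> \<mu> + sep \<mu> c \<le> int (wt c) - 2 * int (c $ i)" for i
      using gap_le[of c i] that by (simp add: Q_def)
    from this[of 1] this[of 2] this[of 3] have "sep \<mu> c \<le> int (wt \<mu>)"
      using assms(2) unfolding sep_3 wt_3 by linarith
    then show ?thesis
      by linarith
  qed
  ultimately obtain c where c: "Q c" "\<And>c'. Q c' \<Longrightarrow> nat (sep \<mu> c') \<le> nat (sep \<mu> c)"
    using ex_has_greatest_nat[of Q \<mu> "\<lambda>c. nat (sep \<mu> c)" "Suc (wt \<mu>)"] by (metis less_imp_le)
  have pos: "\<delta> c \<ge> 1"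
    using c(1) assms(2) sep_nonneg[of \<mu> c] by (simp add: Q_def)
  have "\<delta> s < \<delta> c" if s: "sep s c = 1" for s
  proof (rule ccontr)
    assume "\<not> \<delta> s < \<delta> c"
    moreover have "\<delta> s \<noteq> \<delta> c"
      using even_gap_iff[of s] even_gap_iff[of c] even_sep_iff[of s c] s by auto
    ultimately have up: "\<delta> s = \<delta> c + 1"
      using gap_lipschitz[of s c] s sep_commute[of s c] by linarith
    \<comment> \<open>The Lipschitz bound from \<open>\<mu>\<close> allows the gap
      \<open>\<delta> c + 1\<close> only at distance at least
      \<open>sep \<mu> c + 1\<close>.\<close>
    have far: "sep \<mu> s = sep \<mu> c + 1"
      using gap_lipschitz[of s \<mu>] sep_commute[of s \<mu>] sep_triangle[of \<mu> s c] sep_commute[of s c] s up c(1)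
      by (simp add: Q_def)
    \<comment> \<open>The weight minus twice an entry changes by at most one between neighbours; if
      it were negative at \<open>s\<close>, \<open>gap_le\<close> would give
      \<open>\<delta> c \<le> 0\<close>.\<close>
    have "s \<in> Lambda_bal"
    proof (rule ccontr)
      assume "s \<notin> Lambda_bal"
      then obtain i where i: "2 * s $ i > wt s"
        by (auto simp: Lambda_bal_iff not_le)
      have "\<delta> c \<le> int (wt c) - 2 * int (c $ i)"
        using gap_le[of c i] c(1) by (simp add: Q_def)
      moreover have "int (wt c) - 2 * int (c $ i) \<le> int (wt s) - 2 * int (s $ i) + sep s c"
        using exhaust_3[of i] by (auto simp: sep_3 wt_3)
      ultimately show False
        using s i pos by linarith
    qed
    then have "Q s"
      using up far c(1) by (simp add: Q_def)
    then show False
      using c(2)[of s] far sep_nonneg[of \<mu> c] by linarith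
  qed
  then obtain m \<nu> where "\<nu> \<in> Lambda_bal_odd" "c = p ^ m *s \<nu>" "\<delta> c = int (p ^ m)"
    using peak_is_scaled_odd[of c] pos c(1) Q_def by blast
  then show ?thesis
    using c(1) by (intro exI[of _ m] bexI[of _ \<nu>]) (auto simp: Q_def)
qed

text \<open>From below by \<open>gap_ge_tent\<close>. From above, the gap is the height of some tent
  of scale \<open>m\<close>; \<open>kmax_ge\<close> gives \<open>m \<le> k\<close>, and
  \<open>nested_tents\<close> puts that tent below the one of scale \<open>k\<close>.\<close>

lemma gap_eq_tent:
  assumes "\<mu> \<in> Lambda_bal" "k = kmax p \<mu>" "odd (wt \<nu>)" "sep \<mu> (p ^ k *s \<nu>) < int (p ^ k)"
  shows "\<delta> \<mu> = int (p ^ k) - sep \<mu> (p ^ k *s \<nu>)"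
proof -
  have lower: "int (p ^ k) - sep \<mu> (p ^ k *s \<nu>) \<le> \<delta> \<mu>"
    by (rule gap_ge_tent[OF assms(3)])
  then have pos: "\<delta> \<mu> \<ge> 1"
    using assms(4) by linarith
  obtain m \<nu>' where m: "\<nu>' \<in> Lambda_bal_odd" "\<delta> \<mu> = int (p ^ m) - sep \<mu> (p ^ m *s \<nu>')"
    using gap_is_tent[OF assms(1) pos] by blast
  then have "sep \<mu> (p ^ m *s \<nu>') < int (p ^ m)"
    using pos by linarith
  moreover from this have "m \<le> k"
    using kmax_ge[OF p_ge_2 m(1)] assms(2) by blast
  ultimately show ?thesis
    using nested_tents[of p m k \<nu> \<nu>' \<mu>] p_ge_2 m assms(3,4) lower
    by (auto simp: Lambda_bal_odd_def Lambda_odd_def)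
qed

text \<open>A gap of at least 2 would be the height of a tent of scale
  \<open>m \<le> kmax p \<mu> = 0\<close>, but tents of scale 0 do not exceed 1.\<close>

lemma gap_le_1:
  assumes "\<mu> \<in> Lambda_bal" "kmax p \<mu> = 0"
  shows "\<delta> \<mu> \<le> 1"
proof (rule ccontr)
  assume "\<not> \<delta> \<mu> \<le> 1"
  then obtain m \<nu> where m: "\<nu> \<in> Lambda_bal_odd" "\<delta> \<mu> = int (p ^ m) - sep \<mu> (p ^ m *s \<nu>)"
    using gap_is_tent[OF assms(1)] by auto
  then have "m = 0"
    using kmax_ge[OF p_ge_2 m(1), of \<mu> m] \<open>\<not> \<delta> \<mu> \<le> 1\<close> assms(2) by simp
  then show False
    using m \<open>\<not> \<delta> \<mu> \<le> 1\<close> sep_nonneg[of \<mu> "p ^ m *s \<nu>"] by simp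
qed

end

section \<open>Homogeneous polynomials in two variables\<close>

lemma homogeneous_0: "homogeneous d 0"
  by (simp add: homogeneous_def)

lemma homogeneous_coeff_0: "homogeneous d f \<Longrightarrow> i + j \<noteq> d \<Longrightarrow> coeff (coeff f j) i = 0"
  by (auto simp: homogeneous_def)

lemma homogeneous_add: "homogeneous d f \<Longrightarrow> homogeneous d g \<Longrightarrow> homogeneous d (f + g)"
  by (auto simp: homogeneous_def) (metis add.right_neutral add.left_neutral)

lemma homogeneous_minus: "homogeneous d f \<Longrightarrow> homogeneous d (- f)"
  by (auto simp: homogeneous_def)

lemma homogeneous_mult:
  assumes "homogeneous d f" "homogeneous e g"
  shows "homogeneous (d + e) (f * g)"
  unfolding homogeneous_def
proof (intro allI impI)
  fix i j
  assume "coeff (coeff (f * g) j) i \<noteq> 0"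
  then have "(\<Sum>l\<le>j. coeff (coeff f l * coeff g (j - l)) i) \<noteq> 0"
    by (simp add: coeff_mult coeff_sum)
  then obtain l where l: "l \<le> j" "coeff (coeff f l * coeff g (j - l)) i \<noteq> 0"
    by (auto elim: sum.not_neutral_contains_not_neutral)
  then obtain k where "k \<le> i" "coeff (coeff f l) k * coeff (coeff g (j - l)) (i - k) \<noteq> 0"
    by (auto simp: coeff_mult elim: sum.not_neutral_contains_not_neutral)
  then have "k + l = d" "(i - k) + (j - l) = e" "k \<le> i"
    using assms by (auto simp: homogeneous_def)
  then show "i + j = d + e"
    using l(1) by simp
qed

lemma homogeneous_1: "homogeneous 0 1"
  by (auto simp: homogeneous_def coeff_1 split: if_splits)

lemma homogeneous_power: "homogeneous d f \<Longrightarrow> homogeneous (n * d) (f ^ n)"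
  by (induction n) (auto simp: homogeneous_1 dest: homogeneous_mult)

lemma homogeneous_prod:
  assumes "finite A" "\<And>i. i \<in> A \<Longrightarrow> homogeneous (d i) (f i)"
  shows "homogeneous (\<Sum>i\<in>A. d i) (\<Prod>i\<in>A. f i)"
  using assms by (induction A rule: finite_induct) (auto simp: homogeneous_1 intro!: homogeneous_mult)

lemma homogeneous_sum:
  "(\<And>i. i \<in> A \<Longrightarrow> homogeneous d (f i)) \<Longrightarrow> homogeneous d (\<Sum>i\<in>A. f i)"
  by (induction A rule: infinite_finite_induct) (auto simp: homogeneous_0 intro!: homogeneous_add)

lemma homogeneous_monom: "i + j = d \<Longrightarrow> homogeneous d (monom (monom c i) j)"
  by (auto simp: homogeneous_def split: if_splits)

lemma homogeneous_const: "homogeneous 0 [:[:c:]:]"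
  by (auto simp: homogeneous_def coeff_pCons split: nat.splits)

lemma homogeneous_var_x: "homogeneous 1 var_x"
  by (auto simp: homogeneous_def var_x_def coeff_pCons split: nat.splits)

lemma homogeneous_var_y: "homogeneous 1 var_y"
  by (auto simp: homogeneous_def var_y_def coeff_pCons coeff_1 split: nat.splits if_splits)

lemma homogeneous_alpha_form: "homogeneous 1 (alpha_form i)"
  unfolding alpha_form_def
  by (auto intro: homogeneous_add homogeneous_var_x homogeneous_var_y simp del: One_nat_def)

section \<open>Homogeneous components\<close>

definition homogeneous_part :: "nat \<Rightarrow> 'a::field poly poly \<Rightarrow> 'a poly poly" where
  "homogeneous_part n f = (\<Sum>j\<le>n. monom (monom (coeff (coeff f j) (n - j)) (n - j)) j)"

lemma coeff_homogeneous_part: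
  "coeff (coeff (homogeneous_part n f) j) i = (if i + j = n then coeff (coeff f j) i else 0)"
proof -
  have "coeff (coeff (homogeneous_part n f) j) i =
          (\<Sum>l\<le>n. if l = j then (if n - j = i then coeff (coeff f j) i else 0) else 0)"
    unfolding homogeneous_part_def coeff_sum by (intro sum.cong) auto
  also have "\<dots> = (if i + j = n then coeff (coeff f j) i else 0)"
    by (subst sum.delta) auto
  finally show ?thesis .
qed

lemma homogeneous_homogeneous_part: "homogeneous n (homogeneous_part n f)"
  by (simp add: homogeneous_def coeff_homogeneous_part)

lemma homogeneous_part_add: "homogeneous_part n (f + g) = homogeneous_part n f + homogeneous_part n g"
  by (intro poly_eqI) (simp add: coeff_homogeneous_part)

lemma homogeneous_part_sum: "homogeneous_part n (\<Sum>i\<in>A. f i) = (\<Sum>i\<in>A. homogeneous_part n (f i))"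
  by (intro poly_eqI) (simp add: coeff_homogeneous_part coeff_sum)

lemma homogeneous_part_homogeneous:
  "homogeneous d f \<Longrightarrow> homogeneous_part n f = (if n = d then f else 0)"
  by (intro poly_eqI) (auto simp: coeff_homogeneous_part homogeneous_def)

text \<open>Quantifying over all large \<open>M\<close> lets \<open>homogeneous_part_mult\<close>
  choose a range that also contains the index \<open>n - d\<close>.\<close>

lemma sum_homogeneous_part: "\<exists>N. \<forall>M\<ge>N. f = (\<Sum>n\<le>M. homogeneous_part n f)"
proof (intro exI allI impI)
  fix M assume M: "M \<ge> degree f + (\<Sum>j\<le>degree f. degree (coeff f j))"
  have big: "i + j \<le> M" if "coeff (coeff f j) i \<noteq> 0" for i j
  proof -
    have "j \<le> degree f"
      using that by (intro le_degree) auto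
    moreover from this have "degree (coeff f j) \<le> (\<Sum>j\<le>degree f. degree (coeff f j))"
      by (intro member_le_sum) auto
    moreover have "i \<le> degree (coeff f j)"
      using that by (rule le_degree)
    ultimately show ?thesis using M by linarith
  qed
  show "f = (\<Sum>n\<le>M. homogeneous_part n f)"
  proof (intro poly_eqI)
    fix j i
    have "coeff (coeff (\<Sum>n\<le>M. homogeneous_part n f) j) i =
            (\<Sum>n\<le>M. if n = i + j then coeff (coeff f j) i else 0)"
      unfolding coeff_sum coeff_homogeneous_part by (intro sum.cong) auto
    also have "\<dots> = coeff (coeff f j) i"
      using big[of j i] by (subst sum.delta) auto
    finally show "coeff (coeff f j) i = coeff (coeff (\<Sum>n\<le>M. homogeneous_part n f) j) i" ..
  qed
qed

text \<open>Multiplication by a form of degree \<open>d\<close> shifts every component by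
  \<open>d\<close>; the guard \<open>d \<le> n\<close> accounts for the truncated
  \<open>n - d\<close>.\<close>

lemma homogeneous_part_mult:
  assumes "homogeneous d s"
  shows "homogeneous_part n (f * s) = (if d \<le> n then homogeneous_part (n - d) f * s else 0)"
proof -
  obtain N where "\<forall>M\<ge>N. f = (\<Sum>m\<le>M. homogeneous_part m f)"
    using sum_homogeneous_part by blast
  then have "f = (\<Sum>m\<le>N + n. homogeneous_part m f)"
    by simp
  then have "homogeneous_part n (f * s) = homogeneous_part n ((\<Sum>m\<le>N + n. homogeneous_part m f) * s)"
    by simp
  also have "\<dots> = (\<Sum>m\<le>N + n. homogeneous_part n (homogeneous_part m f * s))"
    by (simp add: homogeneous_part_sum sum_distrib_right)
  also have "\<dots> = (\<Sum>m\<le>N + n. if m = n - d then if d \<le> n then homogeneous_part m f * s else 0 else 0)"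
  proof (intro sum.cong refl)
    fix m
    have "homogeneous (m + d) (homogeneous_part m f * s)"
      by (intro homogeneous_mult homogeneous_homogeneous_part assms)
    then show "homogeneous_part n (homogeneous_part m f * s) =
        (if m = n - d then if d \<le> n then homogeneous_part m f * s else 0 else 0)"
      by (subst homogeneous_part_homogeneous) auto
  qed
  also have "\<dots> = (if d \<le> n then homogeneous_part (n - d) f * s else 0)"
    by (subst sum.delta) auto
  finally show ?thesis .
qed

text \<open>Comparing components of degree \<open>n\<close> and cancelling \<open>s\<close> shows
  that \<open>u\<close> is its own component of degree \<open>n - d\<close>.\<close>

lemma homogeneous_mult_cancel:
  assumes "homogeneous n (u * s)" "homogeneous d s" "s \<noteq> 0" "u \<noteq> 0"
  shows "d \<le> n \<and> homogeneous (n - d) u"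
proof -
  have eq: "homogeneous_part m (u * s) = (if m = n then u * s else 0)" for m
    by (rule homogeneous_part_homogeneous[OF assms(1)])
  have le: "d \<le> n"
    using eq[of n] homogeneous_part_mult[OF assms(2), of n u] assms(3,4) by (auto split: if_splits)
  have "homogeneous_part n (u * s) = u * s"
    using eq by simp
  moreover have "homogeneous_part n (u * s) = homogeneous_part (n - d) u * s"
    using le homogeneous_part_mult[OF assms(2)] by simp
  ultimately have "u * s = homogeneous_part (n - d) u * s"
    by metis
  then have "u = homogeneous_part (n - d) u"
    using assms(3) by (metis mult_right_cancel)
  then show ?thesis
    using le homogeneous_homogeneous_part[of "n - d" u] by simp
qed

section \<open>Dehomogenization at \<open>y = 1\<close>\<close>

lemma coeff_poly_1:
  assumes "homogeneous d F"
  shows "coeff (poly F 1) i = (if i \<le> d then coeff (coeff F (d - i)) i else 0)"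
proof -
  have "coeff (poly F 1) i = (\<Sum>j\<le>degree F. coeff (coeff F j) i)"
    by (simp add: poly_altdef coeff_sum)
  also have "\<dots> = (\<Sum>j\<le>degree F + d. coeff (coeff F j) i)"
    by (intro sum.mono_neutral_left) (auto simp: coeff_eq_0)
  also have "\<dots> = (\<Sum>j\<le>degree F + d. if j = d - i then if i \<le> d then coeff (coeff F j) i else 0 else 0)"
  proof (intro sum.cong refl)
    fix j
    show "coeff (coeff F j) i = (if j = d - i then if i \<le> d then coeff (coeff F j) i else 0 else 0)"
    proof (cases "i + j = d")
      case False
      then have "coeff (coeff F j) i = 0"
        by (rule homogeneous_coeff_0[OF assms])
      then show ?thesis by auto
    qed auto
  qed
  also have "\<dots> = (if i \<le> d then coeff (coeff F (d - i)) i else 0)"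
    by (subst sum.delta) auto
  finally show ?thesis .
qed

lemma degree_poly_1_le: "homogeneous d F \<Longrightarrow> degree (poly F 1) \<le> d"
  by (intro degree_le) (auto simp: coeff_poly_1)

text \<open>In a fixed degree the exponent of \<open>x\<close> determines that of \<open>y\<close>,
  so no two monomials merge at \<open>y = 1\<close>.\<close>

lemma homogeneous_eq_iff:
  assumes "homogeneous d F" "homogeneous d G"
  shows "F = G \<longleftrightarrow> poly F 1 = poly G 1"
proof
  assume eq: "poly F 1 = poly G 1"
  show "F = G"
  proof (intro poly_eqI)
    fix j i
    show "coeff (coeff F j) i = coeff (coeff G j) i"
    proof (cases "i + j = d")
      case True
      then show ?thesis
        using arg_cong[OF eq, of "\<lambda>f. coeff f i"] assms by (auto simp: coeff_poly_1[of d])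
    next
      case False
      then show ?thesis
        using assms by (simp add: homogeneous_coeff_0)
    qed
  qed
qed simp

lemma homogenization_exists:
  fixes f :: "'a::field poly"
  assumes "degree f \<le> d"
  shows "\<exists>F. homogeneous d F \<and> poly F 1 = f"
proof -
  define F where "F = (\<Sum>i\<le>d. monom (monom (coeff f i) i) (d - i))"
  have "homogeneous d F"
    unfolding F_def by (intro homogeneous_sum homogeneous_monom) auto
  moreover have "poly F 1 = (\<Sum>i\<le>d. monom (coeff f i) i)"
    by (simp add: F_def poly_sum poly_monom)
  then have "poly F 1 = f"
    using assms by (simp add: poly_as_sum_of_monoms')
  ultimately show ?thesis
    by blast
qed

section \<open>Homogeneous bases of logarithmic derivations\<close>

lemma alpha_form_simps [simp]:
  "alpha_form 1 = var_x" "alpha_form 2 = var_y" "alpha_form 3 = var_x + var_y"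
  by (simp_all add: alpha_form_def)

lemma alpha_form_nonzero: "alpha_form i \<noteq> (0 :: 'a::field poly poly)"
  using exhaust_3[of i] by (auto simp: var_x_def var_y_def)

lemma map_poly_pderiv_1 [simp]: "map_poly pderiv (1 :: 'a::field poly poly) = 0"
  by (rule poly_eqI) (simp add: coeff_map_poly)

lemma der_apply_alpha_form [simp]:
  "der_apply \<theta> var_x = fst \<theta>"
  "der_apply \<theta> var_y = snd \<theta>"
  "der_apply \<theta> (var_x + var_y) = fst \<theta> + snd \<theta>"
  by (simp_all add: der_apply_def partial_x_def partial_y_def var_x_def var_y_def map_poly_pCons
      pderiv_pCons one_pCons[symmetric])

lemma der_apply_add: "der_apply (\<theta> + \<theta>') h = der_apply \<theta> h + der_apply \<theta>' h"
  by (simp add: der_apply_def algebra_simps)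

lemma der_apply_scale: "der_apply (der_scale s \<theta>) h = s * der_apply \<theta> h"
  by (simp add: der_apply_def der_scale_def algebra_simps)

lemma mem_log_der_iff:
  "\<theta> \<in> log_der t \<longleftrightarrow>
     var_x ^ (t $ 1) dvd fst \<theta> \<and> var_y ^ (t $ 2) dvd snd \<theta> \<and> (var_x + var_y) ^ (t $ 3) dvd fst \<theta> + snd \<theta>"
  by (simp add: log_der_def forall_3)

lemma homogeneous_der_add:
  "homogeneous_der d \<theta> \<Longrightarrow> homogeneous_der d \<theta>' \<Longrightarrow> homogeneous_der d (\<theta> + \<theta>')"
  by (simp add: homogeneous_der_def homogeneous_add)

lemma homogeneous_der_scale:
  "homogeneous e s \<Longrightarrow> homogeneous_der d \<theta> \<Longrightarrow> homogeneous_der (e + d) (der_scale s \<theta>)"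
  by (simp add: homogeneous_der_def der_scale_def homogeneous_mult)

lemma homogeneous_der_apply:
  "homogeneous_der d \<theta> \<Longrightarrow> homogeneous d (der_apply \<theta> (alpha_form i))"
  using exhaust_3[of i] by (auto simp: homogeneous_der_def homogeneous_add)

text \<open>Divisibility by a monic linear polynomial is vanishing at its root. Coefficients from
  any \<open>idom\<close> cover both \<open>'a\<close>, for the form \<open>x\<close>, and
  \<open>'a poly\<close>, for \<open>y\<close> and \<open>x + y\<close>.\<close>

lemma prime_elem_linear: "prime_elem [:c, 1:]" for c :: "'a::idom"
proof (rule prime_elemI)
  fix f g :: "'a poly"
  assume "[:c, 1:] dvd f * g"
  then have "poly (f * g) (- c) = 0"
    using poly_eq_0_iff_dvd[of "f * g" "- c"] by simp
  then show "[:c, 1:] dvd f \<or> [:c, 1:] dvd g"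
    using poly_eq_0_iff_dvd[of f "- c"] poly_eq_0_iff_dvd[of g "- c"] by auto
next
  show "\<not> [:c, 1:] dvd 1"
    using poly_eq_0_iff_dvd[of 1 "- c"] by simp
qed auto

lemma prime_elem_alpha_form: "prime_elem (alpha_form i :: 'a::field poly poly)"
  using exhaust_3[of i] prime_elem_linear[of "0 :: 'a poly"] prime_elem_linear[of "[:0, 1:] :: 'a poly"]
    lift_prime_elem_poly[OF prime_elem_linear[of "0 :: 'a"]]
  by (auto simp: var_x_def var_y_def)

text \<open>A variable that generates the polynomial ring left after setting
  \<open>alpha_form i\<close> to zero.\<close>

definition transversal_form :: "3 \<Rightarrow> 'a::field poly poly" where
  "transversal_form i = (if i = 1 then var_y else var_x)"

lemma homogeneous_transversal_form: "homogeneous 1 (transversal_form i)"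
  unfolding transversal_form_def by (auto intro: homogeneous_var_x homogeneous_var_y simp del: One_nat_def)

lemma alpha_form_dvd_iff:
  "var_x dvd F \<longleftrightarrow> (\<forall>j. coeff (coeff F j) 0 = 0)"
  "var_y dvd F \<longleftrightarrow> poly F 0 = 0"
  "var_x + var_y dvd F \<longleftrightarrow> poly F [:0, - 1:] = 0"
proof -
  show "var_x dvd F \<longleftrightarrow> (\<forall>j. coeff (coeff F j) 0 = 0)"
    using poly_eq_0_iff_dvd[of _ "0 :: 'a"] by (simp add: var_x_def const_poly_dvd_iff poly_0_coeff_0)
  show "var_y dvd F \<longleftrightarrow> poly F 0 = 0"
    by (simp add: var_y_def poly_eq_0_iff_dvd)
  show "var_x + var_y dvd F \<longleftrightarrow> poly F [:0, - 1:] = 0"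
    by (simp add: var_x_def var_y_def poly_eq_0_iff_dvd)
qed

text \<open>Modulo \<open>\<alpha>\<^sub>i\<close> the ring \<open>S\<close> becomes a polynomial ring in one variable, where a form is a
  scalar times a power of that variable.\<close>

lemma homogeneous_mod_alpha_form:
  fixes F :: "'a::field poly poly"
  assumes "homogeneous d F"
  shows "\<exists>c. alpha_form i dvd F - [:[:c:]:] * transversal_form i ^ d"
proof -
  consider "i = 1" | "i = 2" | "i = 3"
    using exhaust_3 by blast
  then show ?thesis
  proof cases
    case 1
    have "var_y ^ d = monom (1 :: 'a poly) d"
      by (simp add: var_y_def monom_altdef)
    then have "coeff (coeff (F - [:[:coeff (coeff F d) 0:]:] * var_y ^ d) j) 0 = 0" for j
      using homogeneous_coeff_0[OF assms, of 0 j] by (cases "j = d") simp_all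
    then have "var_x dvd F - [:[:coeff (coeff F d) 0:]:] * var_y ^ d"
      unfolding alpha_form_dvd_iff by blast
    then show ?thesis
      unfolding 1 transversal_form_def by auto
  next
    case 2
    have "poly F 0 = monom (coeff (coeff F 0) d) d"
      by (intro poly_eqI) (auto simp: poly_0_coeff_0 homogeneous_coeff_0[OF assms])
    then have "poly (F - [:[:coeff (coeff F 0) d:]:] * var_x ^ d) 0 = 0"
      by (simp add: var_x_def poly_power monom_altdef)
    then have "var_y dvd F - [:[:coeff (coeff F 0) d:]:] * var_x ^ d"
      by (simp only: alpha_form_dvd_iff)
    then show ?thesis
      unfolding 2 transversal_form_def by auto
  next
    case 3
    \<comment> \<open>Restriction to the line \<open>x + y = 0\<close> substitutes \<open>-x\<close>
      for \<open>y\<close> and turns each monomial of degree \<open>d\<close> into a sign times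
      \<open>x ^ d\<close>.\<close>
    have "poly F [:0, - 1:] = (\<Sum>j\<le>degree F. coeff F j * [:0, - 1:] ^ j)"
      by (simp add: poly_altdef)
    also have "\<dots> = (\<Sum>j\<le>degree F. smult ((- 1) ^ j * coeff (coeff F j) (d - j)) ([:0, 1:] ^ d))"
    proof (intro sum.cong refl)
      fix j
      have *: "[:0, - 1:] ^ j = smult ((- 1) ^ j) ([:0, 1:: 'a:] ^ j)"
        by (simp flip: smult_power)
      show "coeff F j * [:0, - 1:] ^ j = smult ((- 1) ^ j * coeff (coeff F j) (d - j)) ([:0, 1:] ^ d)"
      proof (cases "coeff F j = 0")
        case False
        then have "j \<le> d"
          using assms unfolding homogeneous_def by (metis le_add2 leading_coeff_0_iff)
        have "coeff F j = monom (coeff (coeff F j) (d - j)) (d - j)"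
          using homogeneous_coeff_0[OF assms, of _ j] \<open>j \<le> d\<close> by (intro poly_eqI) auto
        then have "coeff F j = smult (coeff (coeff F j) (d - j)) ([:0, 1:] ^ (d - j))"
          by (simp add: monom_altdef)
        then have "coeff F j * [:0, - 1:] ^ j =
            smult (coeff (coeff F j) (d - j)) ([:0, 1:] ^ (d - j)) * smult ((- 1) ^ j) ([:0, 1:] ^ j)"
          using * by metis
        then show ?thesis
          using \<open>j \<le> d\<close> by (simp add: mult.commute flip: power_add)
      qed simp
    qed
    also have "\<dots> = smult (\<Sum>j\<le>degree F. (- 1) ^ j * coeff (coeff F j) (d - j)) ([:0, 1:] ^ d)"
      by (simp add: smult_sum)
    finally obtain c where "poly F [:0, - 1:] = smult c ([:0, 1:] ^ d)"
      by blast
    then have "poly (F - [:[:c:]:] * var_x ^ d) [:0, - 1:] = 0"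
      by (simp add: var_x_def poly_power)
    then have "var_x + var_y dvd F - [:[:c:]:] * var_x ^ d"
      by (simp only: alpha_form_dvd_iff)
    then show ?thesis
      unfolding 3 transversal_form_def by auto
  qed
qed

lemma homogeneous_reduction:
  fixes F G :: "'a::field poly poly"
  assumes "homogeneous d F" "homogeneous e G" "d \<le> e" "\<not> alpha_form i dvd F"
  shows "\<exists>h. homogeneous (e - d) h \<and> alpha_form i dvd G - h * F"
proof -
  let ?s = "transversal_form i :: 'a poly poly"
  obtain a b where a: "alpha_form i dvd F - [:[:a:]:] * ?s ^ d" and b: "alpha_form i dvd G - [:[:b:]:] * ?s ^ e"
    using homogeneous_mod_alpha_form assms(1,2) by meson
  have "a \<noteq> 0"
    using a assms(4) by auto
  \<comment> \<open>On the line, \<open>F\<close> and \<open>G\<close> restrict to \<open>a\<close>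
    and \<open>b\<close> times powers of the transversal variable, with \<open>a\<close> nonzero;
    \<open>h\<close> is the quotient of these restrictions.\<close>
  define h where "h = [:[:b / a:]:] * ?s ^ (e - d)"
  have "homogeneous (0 + (e - d) * 1) h"
    unfolding h_def
    by (intro homogeneous_mult homogeneous_const homogeneous_power homogeneous_transversal_form)
  moreover have "h * ([:[:a:]:] * ?s ^ d) = [:[:b:]:] * ?s ^ e"
  proof -
    have "h * ([:[:a:]:] * ?s ^ d) = ([:[:b / a:]:] * [:[:a:]:]) * (?s ^ (e - d) * ?s ^ d)"
      unfolding h_def by (simp only: ac_simps)
    also have "[:[:b / a:]:] * [:[:a:]:] = [:[:b:]:]"
      using \<open>a \<noteq> 0\<close> by simp
    finally show ?thesis
      using assms(3) by (simp flip: power_add)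
  qed
  then have "G - h * F = (G - [:[:b:]:] * ?s ^ e) - h * (F - [:[:a:]:] * ?s ^ d)"
    by (simp add: algebra_simps)
  then have "alpha_form i dvd G - h * F"
    using a b by (metis dvd_diff dvd_mult)
  ultimately show ?thesis
    by auto
qed

text \<open>Span and independence spelled out with coefficients;
  \<open>free_basis_iff_homogeneous_basis\<close> identifies this with
  \<open>homogeneous_basis\<close>.\<close>

definition free_basis ::
    "multiplicity \<Rightarrow> 'a::field der \<Rightarrow> 'a der \<Rightarrow> nat \<Rightarrow> nat \<Rightarrow> bool" where
  "free_basis t \<theta> \<theta>' d d' \<longleftrightarrow> homogeneous_der d \<theta> \<and> homogeneous_der d' \<theta>' \<and>
     (\<forall>\<phi>. \<phi> \<in> log_der t \<longleftrightarrow> (\<exists>p q. \<phi> = der_scale p \<theta> + der_scale q \<theta>')) \<and>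
     (\<forall>p q. der_scale p \<theta> + der_scale q \<theta>' = 0 \<longrightarrow> p = 0 \<and> q = 0)"

section \<open>Existence of free homogeneous bases\<close>

lemma free_basis_commute: "free_basis t \<theta> \<theta>' d d' \<Longrightarrow> free_basis t \<theta>' \<theta> d' d"
  unfolding free_basis_def by (auto simp: add.commute[of "der_scale _ \<theta>"])

lemma free_basis_nonzero:
  assumes "free_basis t \<theta> \<theta>' d d'"
  shows "\<theta> \<noteq> 0" "\<theta>' \<noteq> 0"
proof -
  have "der_scale 1 \<theta> + der_scale 0 \<theta>' \<noteq> 0" "der_scale 0 \<theta> + der_scale 1 \<theta>' \<noteq> 0"
    using assms unfolding free_basis_def by (metis one_neq_zero)+
  then show "\<theta> \<noteq> 0" "\<theta>' \<noteq> 0"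
    by auto
qed

lemma free_basis_mem:
  assumes "free_basis t \<theta> \<theta>' d d'"
  shows "\<theta> \<in> log_der t" "\<theta>' \<in> log_der t"
proof -
  have "\<theta> = der_scale 1 \<theta> + der_scale 0 \<theta>'" "\<theta>' = der_scale 0 \<theta> + der_scale 1 \<theta>'"
    by auto
  then show "\<theta> \<in> log_der t" "\<theta>' \<in> log_der t"
    using assms unfolding free_basis_def by blast+
qed

lemma alpha_form_dvd_alpha_form_imp_eq:
  assumes "alpha_form i dvd (alpha_form j :: 'a::field poly poly)"
  shows "i = j"
proof (rule ccontr)
  assume "i \<noteq> j"
  have "\<not> var_x dvd (var_y :: 'a poly poly)" "\<not> var_x dvd (var_x + var_y :: 'a poly poly)"
  proof -
    have "coeff (coeff (var_y :: 'a poly poly) 1) 0 \<noteq> 0" "coeff (coeff (var_x + var_y :: 'a poly poly) 1) 0 \<noteq> 0"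
      by (simp_all add: var_x_def var_y_def)
    then show "\<not> var_x dvd (var_y :: 'a poly poly)" "\<not> var_x dvd (var_x + var_y :: 'a poly poly)"
      unfolding alpha_form_dvd_iff(1) by blast+
  qed
  moreover have "\<not> var_y dvd (var_x :: 'a poly poly)" "\<not> var_y dvd (var_x + var_y :: 'a poly poly)"
    "\<not> var_x + var_y dvd (var_x :: 'a poly poly)" "\<not> var_x + var_y dvd (var_y :: 'a poly poly)"
    by (simp_all add: alpha_form_dvd_iff(2,3), simp_all add: var_x_def var_y_def)
  ultimately show False
    using assms \<open>i \<noteq> j\<close> exhaust_3[of i] exhaust_3[of j] by auto
qed

text \<open>The product of all the powers \<open>\<alpha>_j ^ s_j\<close>, times a constant
  derivation taking \<open>\<alpha>_i\<close> to 1, has the exact order \<open>s $ i\<close> along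
  the line. Hence raising the entry \<open>i\<close> imposes a proper condition.\<close>

lemma log_der_not_tangent:
  fixes s :: multiplicity
  shows "\<exists>\<psi>\<in>log_der s. \<not> alpha_form i ^ Suc (s $ i) dvd (der_apply \<psi> (alpha_form i) :: 'a::field poly poly)"
proof -
  define Q where "Q = (\<Prod>j\<in>UNIV - {i}. alpha_form j ^ (s $ j) :: 'a poly poly)"
  \<comment> \<open>The derivation by \<open>x\<close> takes both \<open>x\<close> and
    \<open>x + y\<close> to 1; only the form \<open>y\<close> calls for the derivation by
    \<open>y\<close>.\<close>
  define \<xi> :: "'a der" where "\<xi> = (if i = 2 then (0, 1) else (1, 0))"
  define \<psi> where "\<psi> = der_scale (alpha_form i ^ (s $ i) * Q) \<xi>"
  have "\<not> alpha_form i dvd Q"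
  proof
    assume "alpha_form i dvd Q"
    then have "\<exists>j\<in>UNIV - {i}. alpha_form i dvd (alpha_form j ^ (s $ j) :: 'a poly poly)"
      unfolding Q_def prod_unfold_prod_mset
      by (rule prime_elem_dvd_prod_msetE[OF prime_elem_alpha_form]) auto
    then show False
      using prime_elem_dvd_power[OF prime_elem_alpha_form] alpha_form_dvd_alpha_form_imp_eq by blast
  qed
  moreover have "der_apply \<xi> (alpha_form i) = 1"
    using exhaust_3[of i] by (auto simp: \<xi>_def)
  then have "der_apply \<psi> (alpha_form i) = alpha_form i ^ (s $ i) * Q"
    by (simp add: \<psi>_def der_apply_scale)
  ultimately have "\<not> alpha_form i ^ Suc (s $ i) dvd der_apply \<psi> (alpha_form i)"
    using alpha_form_nonzero[of i, where ?'a = 'a] unfolding power_Suc2 by simp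
  moreover have "alpha_form j ^ (s $ j) dvd alpha_form i ^ (s $ i) * Q" for j
  proof (cases "j = i")
    case False
    then have "alpha_form j ^ (s $ j) dvd Q"
      unfolding Q_def by (intro dvd_prodI) auto
    then show ?thesis by simp
  qed simp
  then have "\<psi> \<in> log_der s"
    by (simp add: log_der_def \<psi>_def der_apply_scale)
  ultimately show ?thesis
    by blast
qed

text \<open>Passing from \<open>s\<close> to \<open>s + e\<^sub>i\<close> imposes one linear condition modulo \<open>\<alpha>\<^sub>i\<close> on the coefficients
  with respect to a basis; a change of basis makes this condition affect one coefficient only.\<close>

lemma free_basis_step:
  fixes \<theta> \<theta>' :: "'a::field der"
  assumes basis: "free_basis s \<theta> \<theta>' d d'" and t: "t $ i = Suc (s $ i)" "\<And>j. j \<noteq> i \<Longrightarrow> t $ j = s $ j"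
  shows "\<exists>(\<eta> :: 'a der) \<eta>' e e'. free_basis t \<eta> \<eta>' e e' \<and> e + e' = Suc (d + d')"
proof -
  define \<alpha> :: "'a poly poly" where "\<alpha> = alpha_form i"
  have log_t: "\<phi> \<in> log_der t \<longleftrightarrow> \<phi> \<in> log_der s \<and> \<alpha> ^ Suc (s $ i) dvd der_apply \<phi> \<alpha>" for \<phi> :: "'a der"
  proof
    assume \<phi>: "\<phi> \<in> log_der t"
    have "alpha_form j ^ (s $ j) dvd der_apply \<phi> (alpha_form j)" for j
    proof -
      have "alpha_form j ^ (s $ j) dvd (alpha_form j ^ (t $ j) :: 'a poly poly)"
        using t by (cases "j = i") (auto intro: le_imp_power_dvd)
      then show ?thesis
        using \<phi> by (auto simp: log_der_def intro: dvd_trans)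
    qed
    moreover have "\<alpha> ^ Suc (s $ i) dvd der_apply \<phi> \<alpha>"
      using \<phi> t(1) unfolding log_der_def \<alpha>_def by (metis (mono_tags, lifting) mem_Collect_eq)
    ultimately show "\<phi> \<in> log_der s \<and> \<alpha> ^ Suc (s $ i) dvd der_apply \<phi> \<alpha>"
      by (simp add: log_der_def)
  next
    assume \<phi>: "\<phi> \<in> log_der s \<and> \<alpha> ^ Suc (s $ i) dvd der_apply \<phi> \<alpha>"
    have "alpha_form j ^ (t $ j) dvd der_apply \<phi> (alpha_form j)" for j
      using \<phi> t by (cases "j = i") (auto simp: log_der_def \<alpha>_def simp del: power_Suc)
    then show "\<phi> \<in> log_der t"
      by (simp add: log_der_def)
  qed
  have \<alpha>: "homogeneous 1 \<alpha>" "prime_elem \<alpha>" "\<alpha> \<noteq> 0"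
    unfolding \<alpha>_def by (rule homogeneous_alpha_form prime_elem_alpha_form alpha_form_nonzero)+
  have *: "\<exists>(\<eta> :: 'a der) \<eta>' e e'. free_basis t \<eta> \<eta>' e e' \<and> e + e' = Suc (d + d')"
    if basis: "free_basis s \<theta> \<theta>' d d'" and "d \<le> d'" for \<theta> \<theta>' :: "'a der" and d d'
  proof -
    have hom: "homogeneous_der d \<theta>" "homogeneous_der d' \<theta>'"
      and span: "\<And>\<phi>. \<phi> \<in> log_der s \<longleftrightarrow> (\<exists>p q. \<phi> = der_scale p \<theta> + der_scale q \<theta>')"
      and indep: "\<And>p q. der_scale p \<theta> + der_scale q \<theta>' = 0 \<Longrightarrow> p = 0 \<and> q = 0"
      using basis unfolding free_basis_def by auto
    obtain u where u: "der_apply \<theta> \<alpha> = \<alpha> ^ (s $ i) * u"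
      using free_basis_mem(1)[OF basis] by (auto simp: log_der_def \<alpha>_def elim: dvdE)
    obtain u' where u': "der_apply \<theta>' \<alpha> = \<alpha> ^ (s $ i) * u'"
      using free_basis_mem(2)[OF basis] by (auto simp: log_der_def \<alpha>_def elim: dvdE)
    \<comment> \<open>With \<open>u\<close> and \<open>u'\<close> the values of the basis on
      \<open>\<alpha>\<close> stripped of \<open>\<alpha> ^ (s $ i)\<close>, the new condition is a
      linear congruence modulo \<open>\<alpha>\<close>.\<close>
    have tangent: "\<alpha> ^ Suc (s $ i) dvd der_apply (der_scale p \<theta> + der_scale q \<theta>') \<alpha> \<longleftrightarrow> \<alpha> dvd p * u + q * u'" for p q
    proof -
      have "der_apply (der_scale p \<theta> + der_scale q \<theta>') \<alpha> = \<alpha> ^ (s $ i) * (p * u + q * u')"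
        by (simp add: der_apply_add der_apply_scale u u' algebra_simps)
      then show ?thesis
        using \<alpha>(3) unfolding power_Suc2 by simp
    qed
    have hom\<alpha>: "homogeneous_der (Suc e) (der_scale \<alpha> \<phi>)" if "homogeneous_der e \<phi>" for e \<phi>
      using homogeneous_der_scale[OF \<alpha>(1) that] by simp
    show ?thesis
    proof (cases "\<alpha> dvd u")
      case True
      \<comment> \<open>Otherwise all of \<open>log_der s\<close> would satisfy the new condition,
        against \<open>log_der_not_tangent\<close>. Thus only the coefficient of
        \<open>\<theta>'\<close> is constrained.\<close>
      have "\<not> \<alpha> dvd u'"
      proof
        assume "\<alpha> dvd u'"
        then have "\<alpha> ^ Suc (s $ i) dvd der_apply \<phi> \<alpha>" if "\<phi> \<in> log_der s" for \<phi>
          using that True tangent by (auto simp: span simp del: power_Suc)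
        then show False
          using log_der_not_tangent[of s i] unfolding \<alpha>_def by blast
      qed
      then have tangent': "\<alpha> ^ Suc (s $ i) dvd der_apply (der_scale p \<theta> + der_scale q \<theta>') \<alpha> \<longleftrightarrow> \<alpha> dvd q" for p q
        using True \<alpha>(2) by (simp add: tangent dvd_add_right_iff prime_elem_dvd_mult_iff del: power_Suc)
      have "free_basis t \<theta> (der_scale \<alpha> \<theta>') d (Suc d')"
        unfolding free_basis_def
      proof (intro conjI allI impI)
        fix \<phi>
        show "\<phi> \<in> log_der t \<longleftrightarrow> (\<exists>p q. \<phi> = der_scale p \<theta> + der_scale q (der_scale \<alpha> \<theta>'))"
        proof
          assume \<phi>: "\<phi> \<in> log_der t"
          then obtain p q where pq: "\<phi> = der_scale p \<theta> + der_scale q \<theta>'"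
            unfolding log_t span by blast
          then have "\<alpha> dvd q"
            using \<phi> tangent' unfolding log_t by blast
          then obtain r where "q = \<alpha> * r" ..
          then have "\<phi> = der_scale p \<theta> + der_scale r (der_scale \<alpha> \<theta>')"
            using pq by (simp add: mult.commute)
          then show "\<exists>p q. \<phi> = der_scale p \<theta> + der_scale q (der_scale \<alpha> \<theta>')"
            by blast
        next
          assume "\<exists>p q. \<phi> = der_scale p \<theta> + der_scale q (der_scale \<alpha> \<theta>')"
          then obtain p q where "\<phi> = der_scale p \<theta> + der_scale (q * \<alpha>) \<theta>'"
            by auto
          then show "\<phi> \<in> log_der t"
            using tangent'[of p "q * \<alpha>"] unfolding log_t span by auto
        qed
      next
        fix p q assume "der_scale p \<theta> + der_scale q (der_scale \<alpha> \<theta>') = 0"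
        then have "p = 0 \<and> q * \<alpha> = 0"
          by (intro indep) simp
        then show "p = 0" "q = 0"
          using \<alpha>(3) by auto
      qed (use hom hom\<alpha> in auto)
      then show ?thesis
        by (intro exI[of _ \<theta>] exI[of _ "der_scale \<alpha> \<theta>'"] exI[of _ d] exI[of _ "Suc d'"]) auto
    next
      case False
      \<comment> \<open>The multiplier that makes \<open>\<theta>' - h \<theta>\<close> satisfy the
        congruence. The case \<open>u' = 0\<close> is separate because zero determines no
        degree.\<close>
      obtain h where h: "homogeneous (d' - d) h" "\<alpha> dvd u' - h * u"
      proof (cases "u' = 0")
        case True
        then show ?thesis
          using that[of 0] by (simp add: homogeneous_0)
      next
        case u'_nz: False
        have "u \<noteq> 0"
          using False by auto
        have hom_pow: "homogeneous (s $ i) (\<alpha> ^ (s $ i))"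
          using homogeneous_power[OF \<alpha>(1), of "s $ i"] by simp
        have "homogeneous d (u * \<alpha> ^ (s $ i))" "homogeneous d' (u' * \<alpha> ^ (s $ i))"
          using homogeneous_der_apply[OF hom(1), of i] homogeneous_der_apply[OF hom(2), of i] u u'
          by (simp_all add: \<alpha>_def mult.commute)
        from this[THEN homogeneous_mult_cancel, OF hom_pow] have
          "s $ i \<le> d" "homogeneous (d - s $ i) u" "s $ i \<le> d'" "homogeneous (d' - s $ i) u'"
          using \<open>u \<noteq> 0\<close> u'_nz \<alpha>(3) by auto
        moreover have "(d' - s $ i) - (d - s $ i) = d' - d"
          using \<open>s $ i \<le> d\<close> \<open>d \<le> d'\<close> by simp
        moreover have "d - s $ i \<le> d' - s $ i"
          using \<open>d \<le> d'\<close> by simp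
        ultimately have "\<exists>h. homogeneous (d' - d) h \<and> \<alpha> dvd u' - h * u"
          using homogeneous_reduction[of "d - s $ i" u "d' - s $ i" u' i] False
          unfolding \<alpha>_def by simp
        then show ?thesis
          using that by blast
      qed
      \<comment> \<open>In the basis \<open>\<theta>, \<eta>\<close> the congruence constrains the
        coefficient of \<open>\<theta>\<close> alone, so \<open>\<theta>\<close> absorbs the factor
        \<open>\<alpha>\<close>.\<close>
      define \<eta> where "\<eta> = \<theta>' + der_scale (- h) \<theta>"
      have hom_\<eta>: "homogeneous_der d' \<eta>"
        using homogeneous_der_scale[OF homogeneous_minus[OF h(1)] hom(1)] \<open>d \<le> d'\<close> hom(2)
        unfolding \<eta>_def by (intro homogeneous_der_add) auto
      have comb: "der_scale p \<theta> + der_scale q \<eta> = der_scale (p - q * h) \<theta> + der_scale q \<theta>'" for p q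
        by (simp add: \<eta>_def der_scale_def algebra_simps)
      have tangent': "\<alpha> ^ Suc (s $ i) dvd der_apply (der_scale p \<theta> + der_scale q \<eta>) \<alpha> \<longleftrightarrow> \<alpha> dvd p" for p q
      proof -
        have "(p - q * h) * u + q * u' = p * u + q * (u' - h * u)"
          by (simp add: algebra_simps)
        moreover have "\<alpha> dvd q * (u' - h * u)"
          using h(2) by simp
        ultimately show ?thesis
          using False \<alpha>(2) by (simp add: comb tangent dvd_add_left_iff prime_elem_dvd_mult_iff del: power_Suc)
      qed
      have "free_basis t (der_scale \<alpha> \<theta>) \<eta> (Suc d) d'"
        unfolding free_basis_def
      proof (intro conjI allI impI)
        fix \<phi>
        show "\<phi> \<in> log_der t \<longleftrightarrow> (\<exists>p q. \<phi> = der_scale p (der_scale \<alpha> \<theta>) + der_scale q \<eta>)"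
        proof
          assume \<phi>: "\<phi> \<in> log_der t"
          then obtain p q where "\<phi> = der_scale p \<theta> + der_scale q \<theta>'"
            unfolding log_t span by blast
          then have pq: "\<phi> = der_scale (p + q * h) \<theta> + der_scale q \<eta>"
            by (simp add: comb)
          then have "\<alpha> dvd p + q * h"
            using \<phi> tangent' unfolding log_t by blast
          then obtain r where "p + q * h = \<alpha> * r" ..
          then have "\<phi> = der_scale r (der_scale \<alpha> \<theta>) + der_scale q \<eta>"
            using pq by (simp add: mult.commute)
          then show "\<exists>p q. \<phi> = der_scale p (der_scale \<alpha> \<theta>) + der_scale q \<eta>"
            by blast
        next
          assume "\<exists>p q. \<phi> = der_scale p (der_scale \<alpha> \<theta>) + der_scale q \<eta>"
          then obtain p q where "\<phi> = der_scale (p * \<alpha>) \<theta> + der_scale q \<eta>"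
            by auto
          then show "\<phi> \<in> log_der t"
            using tangent'[of "p * \<alpha>" q] comb[of "p * \<alpha>" q] unfolding log_t span by auto
        qed
      next
        fix p q assume "der_scale p (der_scale \<alpha> \<theta>) + der_scale q \<eta> = 0"
        then have "p * \<alpha> - q * h = 0 \<and> q = 0"
          using comb[of "p * \<alpha>" q] by (intro indep) simp
        then show "p = 0" "q = 0"
          using \<alpha>(3) by auto
      qed (use hom hom\<alpha> hom_\<eta> in auto)
      then show ?thesis
        by (intro exI[of _ "der_scale \<alpha> \<theta>"] exI[of _ \<eta>] exI[of _ "Suc d"] exI[of _ d']) auto
    qed
  qed
  show ?thesis
    using *[OF basis] *[OF free_basis_commute[OF basis]] by (cases "d \<le> d'") (simp_all add: add.commute)
qed

text \<open>Induction on the weight: at multiplicity zero the two partial derivatives form a basis,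
  and each unit added to an entry raises the degree sum by one.\<close>

lemma free_basis_exists:
  "\<exists>(\<theta> :: 'a::field der) \<theta>' d d'. free_basis t \<theta> \<theta>' d d' \<and> d + d' = wt t"
proof (induction "wt t" arbitrary: t)
  case 0
  then have "t = 0"
    by (simp add: wt_3 vec_eq_iff forall_3)
  have "free_basis t (1, 0) ((0, 1) :: 'a der) 0 0"
    unfolding free_basis_def
    by (auto simp: \<open>t = 0\<close> log_der_def homogeneous_der_def homogeneous_0 homogeneous_1 der_scale_def
        zero_prod_def)
  then show ?case
    using 0 by (metis add.right_neutral)
next
  case (Suc n)
  have "\<exists>i. t $ i > 0"
    using Suc.hyps(2) by (auto simp: wt_def intro: ccontr)
  then obtain i where i: "t $ i > 0" ..
  define s where "s = (\<chi> j. if j = i then t $ i - 1 else t $ j)"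
  have s: "t $ i = Suc (s $ i)" "\<And>j. j \<noteq> i \<Longrightarrow> t $ j = s $ j"
    using i by (auto simp: s_def)
  have "wt t = Suc (wt s)"
    using i exhaust_3[of i] by (auto simp: wt_3 s_def)
  then obtain \<theta> \<theta>' :: "'a der" and d d' where "free_basis s \<theta> \<theta>' d d'" "d + d' = n"
    using Suc.hyps(1)[of s] Suc.hyps(2) by auto
  then show ?case
    using free_basis_step[of s \<theta> \<theta>' d d' t i] s Suc.hyps(2) by auto
qed

section \<open>Exponents and the minimal degree\<close>

definition der_part :: "nat \<Rightarrow> 'a::field der \<Rightarrow> 'a der" where
  "der_part n \<theta> = (homogeneous_part n (fst \<theta>), homogeneous_part n (snd \<theta>))"

lemma der_part_add: "der_part n (\<theta> + \<theta>') = der_part n \<theta> + der_part n \<theta>'"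
  by (simp add: der_part_def homogeneous_part_add)

lemma der_part_scale:
  "homogeneous_der d \<theta> \<Longrightarrow>
     der_part n (der_scale s \<theta>) = (if d \<le> n then der_scale (homogeneous_part (n - d) s) \<theta> else 0)"
  by (auto simp: der_part_def der_scale_def homogeneous_der_def homogeneous_part_mult zero_prod_def)

lemma der_part_homogeneous: "homogeneous_der n \<theta> \<Longrightarrow> der_part n \<theta> = \<theta>"
  by (simp add: der_part_def homogeneous_der_def prod_eq_iff homogeneous_part_homogeneous[of n _ n])

lemma free_basis_homogeneous:
  assumes "free_basis t \<theta> \<theta>' d d'"
  shows "homogeneous_der d \<theta>" "homogeneous_der d' \<theta>'"
  using assms unfolding free_basis_def by simp_all

lemma free_basis_span:
  assumes "free_basis t \<theta> \<theta>' d d'" "\<phi> \<in> log_der t"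
  obtains p q where "\<phi> = der_scale p \<theta> + der_scale q \<theta>'"
proof -
  have "\<forall>\<phi>. \<phi> \<in> log_der t \<longleftrightarrow> (\<exists>p q. \<phi> = der_scale p \<theta> + der_scale q \<theta>')"
    using assms(1) unfolding free_basis_def by (elim conjE)
  then show ?thesis
    using assms(2) that by blast
qed

lemma free_basis_independent:
  assumes "free_basis t \<theta> \<theta>' d d'" "der_scale p \<theta> + der_scale q \<theta>' = 0"
  shows "p = 0" "q = 0"
proof -
  have "\<forall>p q. der_scale p \<theta> + der_scale q \<theta>' = 0 \<longrightarrow> p = 0 \<and> q = 0"
    using assms(1) unfolding free_basis_def by (elim conjE)
  then show "p = 0" "q = 0"
    using assms(2) by blast+
qed

text \<open>If \<open>n\<close> were below both degrees, the component of degree \<open>n\<close> of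
  any combination would vanish.\<close>

lemma free_basis_degree_le:
  fixes \<theta> \<phi> :: "'a::field der"
  assumes basis: "free_basis t \<theta> \<theta>' d d'" and \<phi>: "\<phi> \<in> log_der t" "homogeneous_der n \<phi>" "\<phi> \<noteq> 0"
  shows "min d d' \<le> n"
proof -
  obtain p q where "\<phi> = der_scale p \<theta> + der_scale q \<theta>'"
    using free_basis_span[OF basis \<phi>(1)] .
  then have "\<phi> = der_part n (der_scale p \<theta> + der_scale q \<theta>')"
    using der_part_homogeneous[OF \<phi>(2)] by metis
  then show ?thesis
    using \<phi>(3) unfolding der_part_add der_part_scale[OF free_basis_homogeneous(1)[OF basis]]
      der_part_scale[OF free_basis_homogeneous(2)[OF basis]] by (cases "d \<le> n"; cases "d' \<le> n") auto
qed

lemma free_basis_low_degree: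
  fixes \<theta> \<phi> :: "'a::field der"
  assumes basis: "free_basis t \<theta> \<theta>' d d'" and \<phi>: "\<phi> \<in> log_der t" "homogeneous_der n \<phi>" "n < d'"
  shows "\<exists>p. \<phi> = der_scale p \<theta>"
proof -
  obtain p q where "\<phi> = der_scale p \<theta> + der_scale q \<theta>'"
    using free_basis_span[OF basis \<phi>(1)] .
  then have "\<phi> = der_part n (der_scale p \<theta> + der_scale q \<theta>')"
    using der_part_homogeneous[OF \<phi>(2)] by metis
  moreover have "\<dots> = der_scale (if d \<le> n then homogeneous_part (n - d) p else 0) \<theta>"
    using free_basis_homogeneous[OF basis] \<phi>(3) by (simp add: der_part_add der_part_scale)
  ultimately show ?thesis
    by metis
qed

text \<open>Otherwise both elements of the second basis have degree below \<open>d'\<close>, so both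
  are multiples of \<open>\<theta>\<close> and hence dependent.\<close>

lemma free_basis_upper_degree_le:
  fixes \<theta> \<eta> :: "'a::field der"
  assumes 1: "free_basis t \<theta> \<theta>' d d'" and 2: "free_basis t \<eta> \<eta>' e e'" and "e \<le> e'"
  shows "d' \<le> e'"
proof (rule ccontr)
  assume "\<not> d' \<le> e'"
  then have "\<exists>p. \<eta> = der_scale p \<theta>" "\<exists>p. \<eta>' = der_scale p \<theta>"
    using free_basis_low_degree[OF 1 free_basis_mem(1)[OF 2] free_basis_homogeneous(1)[OF 2]]
      free_basis_low_degree[OF 1 free_basis_mem(2)[OF 2] free_basis_homogeneous(2)[OF 2]] \<open>e \<le> e'\<close> by auto
  then obtain p q where pq: "\<eta> = der_scale p \<theta>" "\<eta>' = der_scale q \<theta>"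
    by blast
  then have "der_scale q \<eta> + der_scale (- p) \<eta>' = 0"
    by (simp add: der_scale_def zero_prod_def)
  then have "- p = 0"
    by (rule free_basis_independent(2)[OF 2])
  then show False
    using free_basis_nonzero(1)[OF 2] pq by (simp add: der_scale_def zero_prod_def)
qed

lemma free_basis_degrees_unique:
  fixes \<theta> \<eta> :: "'a::field der"
  assumes 1: "free_basis t \<theta> \<theta>' d d'" and 2: "free_basis t \<eta> \<eta>' e e'"
  shows "{#d, d'#} = {#e, e'#}"
proof -
  have *: "{#d, d'#} = {#e, e'#}" if 1: "free_basis t \<theta> \<theta>' d d'" "d \<le> d'" and 2: "free_basis t \<eta> \<eta>' e e'" "e \<le> e'"
    for \<theta> \<theta>' \<eta> \<eta>' :: "'a der" and d d' e e'
  proof -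
    have "d' = e'"
      using free_basis_upper_degree_le 1 2 by (meson order_antisym)
    moreover have "d \<le> e" "e \<le> d"
      using free_basis_degree_le[OF 1(1) free_basis_mem(1) free_basis_homogeneous(1) free_basis_nonzero(1),
          OF 2(1) 2(1) 2(1)]
        free_basis_degree_le[OF 2(1) free_basis_mem(1) free_basis_homogeneous(1) free_basis_nonzero(1),
          OF 1(1) 1(1) 1(1)] 1(2) 2(2) by auto
    ultimately show ?thesis
      by simp
  qed
  show ?thesis
    using *[of \<theta> \<theta>' d d' \<eta> \<eta>' e e'] *[of \<theta>' \<theta> d' d \<eta> \<eta>' e e'] *[of \<theta> \<theta>' d d' \<eta>' \<eta> e' e]
      *[of \<theta>' \<theta> d' d \<eta>' \<eta> e' e] 1 2 free_basis_commute[OF 1] free_basis_commute[OF 2]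
    by (cases "d \<le> d'"; cases "e \<le> e'") (auto simp: add_mset_commute)
qed

lemma free_basis_iff_homogeneous_basis:
  "free_basis t \<theta> \<theta>' d d' \<longleftrightarrow> homogeneous_basis t \<theta> \<theta>' d d'"
proof -
  have span: "\<phi> \<in> der.span {\<theta>, \<theta>'} \<longleftrightarrow> (\<exists>p q. \<phi> = der_scale p \<theta> + der_scale q \<theta>')" for \<phi> :: "'a der"
    by (auto simp: der.span_breakdown_eq der.span_singleton algebra_simps diff_eq_eq image_iff)
  have indep: "der.independent {\<theta>, \<theta>'} \<longleftrightarrow> (\<forall>p q. der_scale p \<theta> + der_scale q \<theta>' = 0 \<longrightarrow> p = 0 \<and> q = 0)"
    if "\<theta> \<noteq> \<theta>'"
  proof -
    have "der.dependent {\<theta>, \<theta>'} \<longleftrightarrow>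
      (\<exists>u. (\<exists>v\<in>{\<theta>, \<theta>'}. u v \<noteq> 0) \<and> (\<Sum>v\<in>{\<theta>, \<theta>'}. der_scale (u v) v) = 0)"
      by (rule der.dependent_finite) simp
    also have "\<dots> \<longleftrightarrow> (\<exists>u. (u \<theta> \<noteq> 0 \<or> u \<theta>' \<noteq> 0) \<and> der_scale (u \<theta>) \<theta> + der_scale (u \<theta>') \<theta>' = 0)"
      using that by simp
    also have "\<dots> \<longleftrightarrow> (\<exists>p q. (p \<noteq> 0 \<or> q \<noteq> 0) \<and> der_scale p \<theta> + der_scale q \<theta>' = 0)"
    proof
      assume "\<exists>p q. (p \<noteq> 0 \<or> q \<noteq> 0) \<and> der_scale p \<theta> + der_scale q \<theta>' = 0"
      then obtain p q where "p \<noteq> 0 \<or> q \<noteq> 0" "der_scale p \<theta> + der_scale q \<theta>' = 0"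
        by blast
      then show "\<exists>u. (u \<theta> \<noteq> 0 \<or> u \<theta>' \<noteq> 0) \<and> der_scale (u \<theta>) \<theta> + der_scale (u \<theta>') \<theta>' = 0"
        using that by (intro exI[of _ "\<lambda>v. if v = \<theta> then p else q"]) auto
    qed auto
    finally show ?thesis
      by blast
  qed
  \<comment> \<open>Two equal elements satisfy the relation with coefficients 1 and -1.\<close>
  have distinct: "\<theta> \<noteq> \<theta>'" if "\<forall>p q. der_scale p \<theta> + der_scale q \<theta>' = 0 \<longrightarrow> p = 0 \<and> q = 0"
  proof
    assume "\<theta> = \<theta>'"
    then have "der_scale 1 \<theta> + der_scale (- 1) \<theta>' = 0"
      by simp
    then show False
      using that one_neq_zero by metis
  qed
  have "der.span {\<theta>, \<theta>'} = log_der t \<longleftrightarrow>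
      (\<forall>\<phi>. \<phi> \<in> log_der t \<longleftrightarrow> (\<exists>p q. \<phi> = der_scale p \<theta> + der_scale q \<theta>'))"
    unfolding set_eq_iff span by metis
  then show ?thesis
    unfolding free_basis_def homogeneous_basis_def using indep distinct by metis
qed

text \<open>The smaller exponent, described without a basis, so that a single nonzero derivation
  yields an upper bound.\<close>

definition mdr :: "'a::field itself \<Rightarrow> multiplicity \<Rightarrow> nat" where
  "mdr F t = (LEAST d. \<exists>\<theta> :: 'a der. \<theta> \<in> log_der t \<and> homogeneous_der d \<theta> \<and> \<theta> \<noteq> 0)"

lemma mdr_le:
  fixes F :: "'a::field itself" and \<theta> :: "'a der"
  shows "\<theta> \<in> log_der t \<Longrightarrow> homogeneous_der d \<theta> \<Longrightarrow> \<theta> \<noteq> 0 \<Longrightarrow> mdr F t \<le> d"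
  unfolding mdr_def by (intro Least_le) blast

lemma free_basis_mdr:
  fixes F :: "'a::field itself"
  obtains \<theta> \<theta>' :: "'a der" and d' where "free_basis t \<theta> \<theta>' (mdr F t) d'" "mdr F t \<le> d'" "mdr F t + d' = wt t"
proof -
  obtain \<theta> \<theta>' :: "'a der" and d d' where basis: "free_basis t \<theta> \<theta>' d d'" "d + d' = wt t" "d \<le> d'"
  proof -
    obtain \<theta> \<theta>' :: "'a der" and d d' where *: "free_basis t \<theta> \<theta>' d d'" "d + d' = wt t"
      using free_basis_exists by blast
    show ?thesis
      using that[of \<theta> \<theta>' d d'] that[of \<theta>' \<theta> d' d] * free_basis_commute[OF *(1)]
      by (cases "d \<le> d'") (auto simp: add.commute)
  qed
  have "mdr F t = d"
    unfolding mdr_def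
  proof (rule Least_equality)
    show "\<exists>\<theta> :: 'a der. \<theta> \<in> log_der t \<and> homogeneous_der d \<theta> \<and> \<theta> \<noteq> 0"
      using free_basis_mem(1)[OF basis(1)] free_basis_nonzero(1)[OF basis(1)]
        free_basis_homogeneous(1)[OF basis(1)] by blast
    show "d \<le> n" if "\<exists>\<theta> :: 'a der. \<theta> \<in> log_der t \<and> homogeneous_der n \<theta> \<and> \<theta> \<noteq> 0" for n
      using that free_basis_degree_le[OF basis(1)] basis(3) by fastforce
  qed
  then show ?thesis
    using that basis by blast
qed

lemma mdr_witness:
  fixes F :: "'a::field itself"
  obtains \<theta> :: "'a der" where "\<theta> \<in> log_der t" "homogeneous_der (mdr F t) \<theta>" "\<theta> \<noteq> 0"
  by (metis free_basis_homogeneous(1) free_basis_mdr free_basis_mem(1) free_basis_nonzero(1))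

lemma two_mdr_le: "2 * mdr F t \<le> wt t"
  by (rule free_basis_mdr[where t = t and F = F]) linarith

lemma exponents_eq:
  fixes F :: "'a::field itself"
  shows "exponents F t = {#mdr F t, wt t - mdr F t#}"
proof -
  obtain \<theta> \<theta>' :: "'a der" and d' where basis: "free_basis t \<theta> \<theta>' (mdr F t) d'" "mdr F t + d' = wt t"
    using free_basis_mdr by blast
  then have d': "d' = wt t - mdr F t"
    by simp
  show ?thesis
    unfolding exponents_def free_basis_iff_homogeneous_basis[symmetric] d'[symmetric]
  proof (rule the_equality)
    show "\<exists>(\<theta> :: 'a der) \<theta>' e e'. free_basis t \<theta> \<theta>' e e' \<and> {#mdr F t, d'#} = {#e, e'#}"
      using basis(1) by blast
    show "M = {#mdr F t, d'#}"
      if "\<exists>(\<theta> :: 'a der) \<theta>' e e'. free_basis t \<theta> \<theta>' e e' \<and> M = {#e, e'#}" for M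
      using that free_basis_degrees_unique[OF basis(1)] by metis
  qed
qed

lemma Delta_eq: "Delta F t = int (wt t) - 2 * int (mdr F t)"
proof -
  have "\<bar>int d - int d'\<bar> = int (wt t) - 2 * int (mdr F t)" if "exponents F t = {#d, d'#}" for d d'
    using that two_mdr_le[of F t] by (auto simp: exponents_eq add_eq_conv_ex)
  then show ?thesis
    unfolding Delta_def by (intro the_equality) (metis exponents_eq)+
qed

section \<open>Wronskians and peaks of the gap\<close>

text \<open>A factor that does not vanish at \<open>r\<close> contributes nothing to the order at
  \<open>r\<close>.\<close>

lemma linear_power_dvd_mult_cancel:
  fixes h q :: "'a::field poly"
  assumes "[:- r, 1:] ^ n dvd h * q" "poly h r \<noteq> 0"
  shows "[:- r, 1:] ^ n dvd q"
proof -
  have "h \<noteq> 0"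
    using assms(2) by auto
  then show ?thesis
    using assms by (cases "q = 0") (auto simp: order_divides order_mult order_0I)
qed

lemma linear_powers_dvd:
  fixes f :: "'a::field poly"
  assumes "[:0, 1:] ^ m dvd f" "[:1, 1:] ^ n dvd f"
  shows "[:0, 1:] ^ m * [:1, 1:] ^ n dvd f"
proof -
  obtain q where q: "f = [:0, 1:] ^ m * q"
    using assms(1) ..
  then have "[:- (- 1), 1:] ^ n dvd [:0, 1:] ^ m * q"
    using assms(2) by simp
  then have "[:- (- 1), 1:] ^ n dvd q"
    by (rule linear_power_dvd_mult_cancel) (simp add: poly_power)
  then show ?thesis
    using q by (simp add: mult_dvd_mono)
qed

lemma degree_linear_powers: "degree ([:0, 1:] ^ m * [:1, 1:] ^ n :: 'a::field poly) = m + n"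
  by (simp add: degree_mult_eq degree_linear_power)

lemma power_dvd_pderiv:
  fixes h :: "'a::field poly"
  assumes "h ^ n dvd f"
  shows "h ^ (n - 1) dvd pderiv f"
proof -
  obtain q where q: "f = h ^ n * q"
    using assms ..
  show ?thesis
  proof (cases n)
    case (Suc m)
    have "pderiv f = h ^ Suc m * pderiv q + q * (smult (of_nat (Suc m)) (h ^ m) * pderiv h)"
      unfolding q Suc pderiv_mult pderiv_power_Suc ..
    also have "h ^ m dvd \<dots>"
      by (intro dvd_add dvd_mult dvd_mult2 dvd_smult) (auto intro: dvd_smult)
    finally show ?thesis
      by (simp add: Suc)
  qed simp
qed

lemma degree_pderiv_less:
  fixes f :: "'a::field poly"
  assumes "pderiv f \<noteq> 0"
  shows "degree (pderiv f) < degree f"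
proof -
  have "degree f \<noteq> 0"
    using assms by (metis degree_eq_zeroE pderiv_singleton)
  moreover have "degree (pderiv f) \<le> degree f - 1"
    by (intro degree_le) (auto simp: coeff_pderiv coeff_eq_0)
  ultimately show ?thesis
    by simp
qed

text \<open>A nonzero combination of least degree divides every combination, by division with
  remainder.\<close>

lemma poly_bezout:
  fixes f g :: "'a::field poly"
  assumes "f \<noteq> 0"
  obtains h u v where "h = u * f + v * g" "h \<noteq> 0" "h dvd f" "h dvd g"
proof -
  define I where "I = {u * f + v * g | u v. u * f + v * g \<noteq> 0}"
  have "1 * f + 0 * g \<in> I"
    using assms unfolding I_def by (intro CollectI exI[of _ 1] exI[of _ 0]) auto
  then obtain h where h: "h \<in> I" "\<And>h'. h' \<in> I \<Longrightarrow> degree h \<le> degree h'"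
    using ex_has_least_nat[of "\<lambda>h. h \<in> I" _ degree] by blast
  then obtain u v where uv: "h = u * f + v * g" "h \<noteq> 0"
    by (auto simp: I_def)
  have dvd: "h dvd a * f + b * g" for a b
  proof (rule ccontr)
    assume not_dvd: "\<not> h dvd a * f + b * g"
    define q where "q = (a * f + b * g) div h"
    define r where "r = (a * f + b * g) mod h"
    have "r \<noteq> 0"
      using not_dvd by (simp add: r_def mod_eq_0_iff_dvd)
    moreover have "r = (a - q * u) * f + (b - q * v) * g"
    proof -
      have "r = (a * f + b * g) - q * h"
        by (simp add: r_def q_def minus_div_mult_eq_mod)
      then show ?thesis
        by (simp add: uv(1) algebra_simps)
    qed
    ultimately have "r \<in> I"
      unfolding I_def by blast
    then show False
      using h(2)[of r] degree_mod_less[OF uv(2), of "a * f + b * g"] \<open>r \<noteq> 0\<close> by (auto simp: r_def)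
  qed
  show ?thesis
    using that[OF uv] dvd[of 1 0] dvd[of 0 1] by simp
qed

text \<open>A Bezout identity with unit left side turns the relation into
  \<open>f dvd pderiv f\<close>, which by degrees forces \<open>pderiv f = 0\<close>.\<close>

lemma wronskian_0_imp_pderiv_0:
  fixes f g :: "'a::field poly"
  assumes "pderiv f * g = f * pderiv g" "f \<noteq> 0"
    and coprime: "\<And>h. h dvd f \<Longrightarrow> h dvd g \<Longrightarrow> degree h = 0"
  shows "pderiv f = 0" "pderiv g = 0"
proof -
  obtain h u v where h: "h = u * f + v * g" "h \<noteq> 0" "h dvd f" "h dvd g"
    using poly_bezout[OF assms(2)] by blast
  have "pderiv f * h = f * (u * pderiv f + v * pderiv g)"
    unfolding h(1) using assms(1) by (simp add: algebra_simps)
  then have "f dvd pderiv f * h"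
    by (rule dvdI)
  moreover have "h dvd 1"
    using coprime[OF h(3,4)] h(2) by (simp add: is_unit_iff_degree)
  ultimately have "f dvd pderiv f"
    by (simp add: dvd_mult_unit_iff)
  then show "pderiv f = 0"
    using degree_pderiv_less[of f] dvd_imp_degree_le[of f "pderiv f"] by fastforce
  then show "pderiv g = 0"
    using assms(1,2) by simp
qed

text \<open>Only exponents divisible by \<open>p\<close> occur, and on a finite field the injective
  Frobenius map is onto, so all coefficients have \<open>p\<close>-th roots.\<close>

lemma pderiv_0_imp_power:
  fixes f :: "'a::field poly"
  assumes char: "CHAR('a) = p" "prime p" and fin: "finite (UNIV :: 'a set)" and "pderiv f = 0"
  shows "\<exists>g. f = g ^ p"
proof -
  have p: "prime CHAR('a)" "p > 0"
    using char prime_gt_0_nat by auto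
  have "inj (\<lambda>x :: 'a. x ^ p)"
  proof (rule injI)
    fix x y :: 'a
    assume "x ^ p = y ^ p"
    moreover have "((x - y) + y) ^ p = (x - y) ^ p + y ^ p"
      by (rule freshmans_dream[OF p(1)]) (simp add: char)
    ultimately have "(x - y) ^ p = 0"
      by simp
    then show "x = y"
      by simp
  qed
  then have "surj (\<lambda>x :: 'a. x ^ p)"
    using fin by (simp add: finite_UNIV_inj_surj)
  then have "\<forall>x :: 'a. \<exists>y. y ^ p = x"
    by (metis surjD)
  then obtain root :: "'a \<Rightarrow> 'a" where root: "root x ^ p = x" for x
    by metis
  have coeff_0: "coeff f n = 0" if "\<not> p dvd n" for n
  proof (cases n)
    case (Suc m)
    have "of_nat (Suc m) * coeff f (Suc m) = 0"
      using assms(4) by (metis coeff_pderiv coeff_0)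
    moreover have "of_nat (Suc m) \<noteq> (0 :: 'a)"
      using that Suc char(1) by (simp only: of_nat_eq_0_iff_char_dvd) simp
    ultimately show ?thesis
      using Suc by simp
  qed (use that in simp)
  define g where "g = (\<Sum>i\<le>degree f. monom (root (coeff f (p * i))) i)"
  have "g ^ p = (\<Sum>i\<le>degree f. monom (root (coeff f (p * i))) i ^ p)"
    unfolding g_def by (intro freshmans_dream_sum) (simp_all add: char)
  also have "\<dots> = (\<Sum>i\<le>degree f. monom (coeff f (p * i)) (p * i))"
    by (simp add: monom_power root mult.commute)
  also have "\<dots> = f"
  proof (rule poly_eqI)
    fix n
    have "coeff (\<Sum>i\<le>degree f. monom (coeff f (p * i)) (p * i)) n =
        (\<Sum>i\<le>degree f. if p * i = n then coeff f n else 0)"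
      unfolding coeff_sum by (intro sum.cong) auto
    also have "\<dots> = coeff f n"
    proof (cases "p dvd n")
      case True
      then obtain j where j: "n = p * j" ..
      have "(\<Sum>i\<le>degree f. if p * i = n then coeff f n else 0) = (\<Sum>i\<le>degree f. if i = j then coeff f n else 0)"
        using p(2) j by (intro sum.cong) auto
      also have "\<dots> = (if j \<le> degree f then coeff f n else 0)"
        by (subst sum.delta) auto
      also have "\<dots> = coeff f n"
      proof -
        have "j \<le> n"
          using j p(2) by simp
        then show ?thesis
          using coeff_eq_0[of f n] by auto
      qed
      finally show ?thesis .
    next
      case False
      then show ?thesis
        by (auto simp: coeff_0 intro!: sum.neutral)
    qed
    finally show "coeff (\<Sum>i\<le>degree f. monom (coeff f (p * i)) (p * i)) n = coeff f n" .
  qed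
  finally show ?thesis
    by metis
qed

text \<open>Setting \<open>y = 1\<close> turns a homogeneous logarithmic derivation of degree \<open>d\<close> into a pair of
  polynomials in \<open>x\<close>; divisibility by powers of \<open>y\<close> becomes a bound on the degree.\<close>

definition affine_der :: "nat \<Rightarrow> multiplicity \<Rightarrow> 'a::field poly \<Rightarrow> 'a poly \<Rightarrow> bool" where
  "affine_der d t f g \<longleftrightarrow> degree f \<le> d \<and> (g = 0 \<or> degree g + t $ 2 \<le> d) \<and>
     [:0, 1:] ^ (t $ 1) dvd f \<and> [:1, 1:] ^ (t $ 3) dvd f + g"

section \<open>Logarithmic derivations as pairs of polynomials in \<open>x\<close>\<close>

lemma poly_var_1 [simp]: "poly var_x 1 = [:0, 1:]" "poly var_y 1 = 1"
  by (simp_all add: var_x_def var_y_def)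

lemma poly_1_eq_0_iff: "homogeneous d F \<Longrightarrow> poly F 1 = 0 \<longleftrightarrow> F = 0"
  using homogeneous_eq_iff[of d F 0] by (auto simp: homogeneous_0)

lemma poly_var_sum_1: "poly (var_x + var_y) 1 = [:1, 1:]"
  by (simp, simp add: one_pCons)

lemma log_der_imp_affine_der:
  assumes "\<theta> \<in> log_der t" "homogeneous_der d \<theta>"
  shows "affine_der d t (poly (fst \<theta>) 1) (poly (snd \<theta>) 1)"
proof -
  have hom: "homogeneous d (fst \<theta>)" "homogeneous d (snd \<theta>)"
    using assms(2) by (auto simp: homogeneous_der_def)
  have dvd: "var_x ^ (t $ 1) dvd fst \<theta>" "var_y ^ (t $ 2) dvd snd \<theta>"
    "(var_x + var_y) ^ (t $ 3) dvd fst \<theta> + snd \<theta>"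
    using assms(1) by (auto simp: mem_log_der_iff)
  have poly_dvd: "poly F 1 dvd poly G 1" if "F dvd G" for F G :: "'a poly poly"
    using that by (auto elim: dvdE)
  have "poly (snd \<theta>) 1 = 0 \<or> degree (poly (snd \<theta>) 1) + t $ 2 \<le> d"
  proof (cases "snd \<theta> = 0")
    case False
    obtain Q where Q: "snd \<theta> = var_y ^ (t $ 2) * Q"
      using dvd(2) ..
    have "homogeneous (t $ 2) (var_y ^ (t $ 2) :: 'a poly poly)"
      using homogeneous_power[OF homogeneous_var_y, of "t $ 2"] by simp
    then have "t $ 2 \<le> d \<and> homogeneous (d - t $ 2) Q"
      using homogeneous_mult_cancel[of d Q "var_y ^ (t $ 2)"] hom(2) False Q by (auto simp: mult.commute)
    then show ?thesis
      using degree_poly_1_le[of "d - t $ 2" Q] by (auto simp: Q poly_power)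
  qed simp
  then show ?thesis
    using degree_poly_1_le[OF hom(1)] poly_dvd[OF dvd(1)] poly_dvd[OF dvd(3)]
    unfolding affine_der_def poly_power poly_var_sum_1 by (simp add: poly_power)
qed

text \<open>Homogenizing the quotient \<open>q\<close> in degree \<open>d - e\<close> and
  multiplying by \<open>A\<close> gives back \<open>F\<close>, because a form of known degree is
  determined at \<open>y = 1\<close>.\<close>

lemma homogenization_dvd:
  assumes "homogeneous d F" "homogeneous e A" "poly F 1 = poly A 1 * q" "q = 0 \<or> degree q + e \<le> d"
  shows "A dvd F"
proof (cases "q = 0")
  case True
  then show ?thesis
    using assms(1,3) poly_1_eq_0_iff by fastforce
next
  case False
  then obtain Q where Q: "homogeneous (d - e) Q" "poly Q 1 = q"
    using homogenization_exists[of q "d - e"] assms(4) by fastforce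
  have "homogeneous d (A * Q)"
    using homogeneous_mult[OF assms(2) Q(1)] False assms(4) by simp
  then have "F = A * Q"
    using homogeneous_eq_iff[OF assms(1)] assms(3) Q(2) by simp
  then show ?thesis
    by simp
qed

text \<open>Homogenizing \<open>f\<close> and \<open>g\<close> in degree \<open>d\<close> gives a
  logarithmic derivation; the missing degree of \<open>g\<close> becomes the power of
  \<open>y\<close>.\<close>

lemma mdr_le_affine_der:
  fixes F :: "'a::field itself" and f g :: "'a poly"
  assumes aff: "affine_der d t f g" and "f \<noteq> 0 \<or> g \<noteq> 0"
  shows "mdr F t \<le> d"
proof -
  have deg: "degree f \<le> d" "degree g \<le> d"
    using aff by (auto simp: affine_der_def)
  obtain F' G' where F': "homogeneous d F'" "poly F' 1 = f" and G': "homogeneous d G'" "poly G' 1 = g"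
    using homogenization_exists deg by metis
  have hom: "homogeneous m (var_x ^ m :: 'a poly poly)" "homogeneous m (var_y ^ m :: 'a poly poly)"
    "homogeneous m ((var_x + var_y) ^ m :: 'a poly poly)" for m
    using homogeneous_power[OF homogeneous_var_x, of m] homogeneous_power[OF homogeneous_var_y, of m]
      homogeneous_power[OF homogeneous_add[OF homogeneous_var_x homogeneous_var_y], of m] by simp_all
  have "var_x ^ (t $ 1) dvd F'"
  proof -
    obtain q where q: "f = [:0, 1:] ^ (t $ 1) * q"
      using aff by (auto simp: affine_der_def elim: dvdE)
    have "q = 0 \<or> degree q + t $ 1 \<le> d"
      using deg(1) unfolding q by (cases "q = 0") (auto simp: degree_mult_eq degree_linear_power)
    then show ?thesis
      using q by (intro homogenization_dvd[OF F'(1) hom(1)]) (simp_all add: F'(2) poly_power)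
  qed
  moreover have "var_y ^ (t $ 2) dvd G'"
    using aff by (intro homogenization_dvd[OF G'(1) hom(2), of _ g]) (auto simp: affine_der_def G'(2) poly_power)
  moreover have "(var_x + var_y) ^ (t $ 3) dvd F' + G'"
  proof -
    obtain q where q: "f + g = [:1, 1:] ^ (t $ 3) * q"
      using aff by (auto simp: affine_der_def elim: dvdE)
    have "degree (f + g) \<le> d"
      using deg by (rule degree_add_le)
    then have "q = 0 \<or> degree q + t $ 3 \<le> d"
      unfolding q by (cases "q = 0") (auto simp: degree_mult_eq degree_linear_power)
    then show ?thesis
      using q by (intro homogenization_dvd[OF homogeneous_add[OF F'(1) G'(1)] hom(3)])
        (simp_all only: poly_power poly_var_sum_1 poly_add[of F' G'] F'(2) G'(2))
  qed
  ultimately have "(F', G') \<in> log_der t"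
    by (simp add: mem_log_der_iff)
  moreover have "(F', G') \<noteq> 0"
    using assms(2) F'(2) G'(2) by (auto simp: zero_prod_def)
  ultimately show ?thesis
    using F'(1) G'(1) by (intro mdr_le) (auto simp: homogeneous_der_def)
qed

section \<open>Bounds for the smaller exponent\<close>

lemma mdr_affine_witness:
  fixes F :: "'a::field itself"
  obtains f g :: "'a poly" where "affine_der (mdr F t) t f g" "f \<noteq> 0 \<or> g \<noteq> 0"
proof -
  obtain \<theta> :: "'a der" where \<theta>: "\<theta> \<in> log_der t" "homogeneous_der (mdr F t) \<theta>" "\<theta> \<noteq> 0"
    using mdr_witness .
  have "poly (fst \<theta>) 1 \<noteq> 0 \<or> poly (snd \<theta>) 1 \<noteq> 0"
    using \<theta>(2,3) by (auto simp: homogeneous_der_def poly_1_eq_0_iff prod_eq_iff)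
  then show ?thesis
    using that log_der_imp_affine_der[OF \<theta>(1,2)] by blast
qed

text \<open>If \<open>f\<close>, \<open>g\<close> and \<open>f + g\<close> are nonzero, each bounds
  one entry by the degree. If one of them vanishes, the degree is at least the sum of two entries,
  which by balance is at least the third.\<close>

lemma mdr_ge_balanced:
  assumes "t \<in> Lambda_bal"
  shows "t $ i \<le> mdr F t"
proof -
  obtain f g :: "'a poly" where aff: "affine_der (mdr F t) t f g" and nz: "f \<noteq> 0 \<or> g \<noteq> 0"
    using mdr_affine_witness .
  define d where "d = mdr F t"
  have f: "f = 0 \<or> t $ 1 \<le> d"
    using aff dvd_imp_degree_le[of "[:0, 1:] ^ (t $ 1)" f]
    by (cases "f = 0") (auto simp: affine_der_def d_def degree_linear_power)
  have g: "g = 0 \<or> t $ 2 \<le> d"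
    using aff by (auto simp: affine_der_def d_def)
  have deg_fg: "degree (f + g) \<le> d"
    using aff by (intro degree_add_le) (auto simp: affine_der_def d_def)
  then have fg: "f + g = 0 \<or> t $ 3 \<le> d"
    using aff dvd_imp_degree_le[of "[:1, 1:] ^ (t $ 3)" "f + g"]
    by (cases "f + g = 0") (auto simp: affine_der_def d_def degree_linear_power)
  have "t $ 2 + t $ 3 \<le> d" if "f = 0"
    using aff nz that dvd_imp_degree_le[of "[:1, 1:] ^ (t $ 3)" g]
    by (auto simp: affine_der_def d_def degree_linear_power)
  moreover have "t $ 1 + t $ 3 \<le> d" if "g = 0"
    using aff nz that dvd_imp_degree_le[OF linear_powers_dvd[of "t $ 1" f "t $ 3"]]
    unfolding degree_linear_powers by (auto simp: affine_der_def d_def)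
  moreover have "t $ 1 + t $ 2 \<le> d" if "f + g = 0"
  proof -
    have "g = - f" "f \<noteq> 0"
      using that nz by (auto simp: eq_neg_iff_add_eq_0 add.commute)
    then show ?thesis
      using aff dvd_imp_degree_le[of "[:0, 1:] ^ (t $ 1)" f]
      by (auto simp: affine_der_def d_def degree_linear_power)
  qed
  ultimately show ?thesis
    using f g fg assms exhaust_3[of i] nz unfolding d_def[symmetric]
    by (auto simp: Lambda_bal_iff wt_3 forall_3)
qed

text \<open>Multiplying by \<open>\<alpha>_i ^ (s_i - t_i)\<close> for all \<open>i\<close>, with
  truncated subtraction, costs degree only where the entry grows. In terms of \<open>Delta\<close>
  this is the Lipschitz bound, as twice the sum of the increases is
  \<open>wt s - wt t + sep s t\<close>.\<close>

lemma mdr_lipschitz: "int (mdr F s) \<le> int (mdr F t) + (\<Sum>i\<in>UNIV. int (s $ i - t $ i))"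
  for F :: "'a::field itself"
proof -
  obtain \<theta> :: "'a der" where \<theta>: "\<theta> \<in> log_der t" "homogeneous_der (mdr F t) \<theta>" "\<theta> \<noteq> 0"
    using mdr_witness .
  define P :: "'a poly poly" where "P = (\<Prod>i\<in>UNIV. alpha_form i ^ (s $ i - t $ i))"
  have "homogeneous (s $ i - t $ i) (alpha_form i ^ (s $ i - t $ i) :: 'a poly poly)" for i
    using homogeneous_power[OF homogeneous_alpha_form, of "s $ i - t $ i" i] by simp
  then have "homogeneous (\<Sum>i\<in>UNIV. s $ i - t $ i) P"
    unfolding P_def by (intro homogeneous_prod) auto
  then have "homogeneous_der ((\<Sum>i\<in>UNIV. s $ i - t $ i) + mdr F t) (der_scale P \<theta>)"
    using \<theta>(2) by (rule homogeneous_der_scale)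
  moreover have "der_scale P \<theta> \<in> log_der s"
    unfolding log_der_def
  proof (intro CollectI allI)
    fix i
    have "alpha_form i ^ (s $ i - t $ i) dvd P"
      unfolding P_def by (intro dvd_prodI) auto
    moreover have "alpha_form i ^ (t $ i) dvd der_apply \<theta> (alpha_form i)"
      using \<theta>(1) by (auto simp: log_der_def)
    ultimately have "alpha_form i ^ (s $ i - t $ i) * alpha_form i ^ (t $ i) dvd der_apply (der_scale P \<theta>) (alpha_form i)"
      unfolding der_apply_scale by (rule mult_dvd_mono)
    moreover have "alpha_form i ^ (s $ i) dvd alpha_form i ^ (s $ i - t $ i) * (alpha_form i ^ (t $ i) :: 'a poly poly)"
      unfolding power_add[symmetric] by (rule le_imp_power_dvd) simp
    ultimately show "alpha_form i ^ (s $ i) dvd der_apply (der_scale P \<theta>) (alpha_form i)"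
      by (rule dvd_trans[rotated])
  qed
  moreover have "der_scale P \<theta> \<noteq> 0"
    using \<theta>(3) alpha_form_nonzero by (auto simp: der_scale_def P_def prod_eq_iff)
  ultimately have "mdr F s \<le> (\<Sum>i\<in>UNIV. s $ i - t $ i) + mdr F t"
    by (intro mdr_le)
  then show ?thesis
    by (simp flip: of_nat_sum of_nat_add)
qed

text \<open>Raising both components to the power \<open>p\<close> is additive in characteristic
  \<open>p\<close>, so the condition on the sum of the components survives as well.\<close>

lemma mdr_frobenius:
  fixes F :: "'a::field itself"
  assumes "CHAR('a) = p" "prime p"
  shows "mdr F (p *s t) \<le> p * mdr F t"
proof -
  obtain \<theta> :: "'a der" where \<theta>: "\<theta> \<in> log_der t" "homogeneous_der (mdr F t) \<theta>" "\<theta> \<noteq> 0"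
    using mdr_witness .
  define \<eta> where "\<eta> = (fst \<theta> ^ p, snd \<theta> ^ p)"
  have "homogeneous_der (p * mdr F t) \<eta>"
    using \<theta>(2) by (simp add: \<eta>_def homogeneous_der_def homogeneous_power)
  moreover have "(fst \<theta> + snd \<theta>) ^ p = fst \<theta> ^ p + snd \<theta> ^ p"
    by (rule freshmans_dream) (simp_all add: assms)
  then have "\<eta> \<in> log_der (p *s t)"
    using \<theta>(1) dvd_power_same[of _ "fst \<theta> + snd \<theta>" p]
    by (auto simp: mem_log_der_iff \<eta>_def mult.commute[of p] power_mult dvd_power_same)
  moreover have "\<eta> \<noteq> 0"
    using \<theta>(3) by (auto simp: \<eta>_def prod_eq_iff)
  ultimately show ?thesis
    by (intro mdr_le)
qed

text \<open>Mason's argument. At a peak a minimal derivation becomes a coprime pair \<open>f, g\<close> for which the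
  divisibility conditions hold with exact exponents. Then the Wronskian of \<open>f\<close> and \<open>g\<close> is too
  divisible for its degree, so it vanishes, which makes \<open>f\<close> and \<open>g\<close> \<open>p\<close>-th powers.\<close>

lemma mdr_peak:
  fixes F :: "'a::field itself"
  assumes char: "CHAR('a) = p" "prime p" and fin: "finite (UNIV :: 'a set)"
    and up: "\<And>i. mdr F t < mdr F (t + axis i 1)"
    and down: "\<And>s i. s + axis i 1 = t \<Longrightarrow> mdr F t \<le> mdr F s"
    and gap: "2 * mdr F t + 2 \<le> wt t"
  shows "\<exists>s. t = p *s s \<and> p * mdr F s \<le> mdr F t"
proof -
  define d where "d = mdr F t"
  define a where "a = t $ 1"
  define b where "b = t $ 2"
  define c where "c = t $ 3"
  have p_pos: "p > 0"
    using char(2) prime_gt_0_nat by blast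
  obtain f g :: "'a poly" where aff: "affine_der d t f g" and nz: "f \<noteq> 0 \<or> g \<noteq> 0"
    using mdr_affine_witness[of F t] unfolding d_def by metis
  have aff': "degree f \<le> d" "g = 0 \<or> degree g + b \<le> d" "[:0, 1:] ^ a dvd f" "[:1, 1:] ^ c dvd f + g"
    using aff by (auto simp: affine_der_def a_def b_def c_def)
  \<comment> \<open>The pair fails for every raised multiplicity. Hence the orders of
    \<open>f\<close> at 0 and of \<open>f + g\<close> at -1, and the degree of \<open>g\<close>, are
    exact.\<close>
  have no_up: "\<not> affine_der d (t + axis i 1) f g" for i
    using mdr_le_affine_der[of d "t + axis i 1" f g F] nz up[of i] by (auto simp: d_def)
  \<comment> \<open>Neither at \<open>t\<close> nor at a lower neighbour is there a solution of
    degree below \<open>d\<close>; each common factor will be excluded by dividing it out.\<close>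
  have no_small: "\<not> affine_der e s f' g'" if "e < d" "s = t \<or> s + axis i 1 = t" "f' \<noteq> 0 \<or> g' \<noteq> 0" for e s i and f' g' :: "'a poly"
    using that mdr_le_affine_der[of e s f' g' F] down[of s i] by (auto simp: d_def)
  have ax: "axis i (Suc 0) $ j = (if j = i then 1 else 0)" for i j :: 3
    by (simp add: axis_def)
  have f_exact: "\<not> [:0, 1:] ^ Suc a dvd f"
    using no_up[of 1] aff' by (auto simp: affine_der_def ax a_def b_def c_def simp del: power_Suc)
  have g_exact: "g \<noteq> 0" "degree g + b = d"
    using no_up[of 2] aff' by (auto simp: affine_der_def ax a_def b_def c_def)
  have fg_exact: "\<not> [:1, 1:] ^ Suc c dvd f + g"
    using no_up[of 3] aff' by (auto simp: affine_der_def ax a_def b_def c_def simp del: power_Suc)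
  have f_nz: "f \<noteq> 0" and fg_nz: "f + g \<noteq> 0"
    using f_exact fg_exact by auto
  \<comment> \<open>Otherwise the homogenized pair has the common factor \<open>y\<close>; dividing
    by it lowers the degree to \<open>d - 1\<close> and the second entry to
    \<open>b - 1\<close>.\<close>
  have degree_max: "b = 0 \<or> degree f = d"
  proof (rule ccontr)
    assume *: "\<not> (b = 0 \<or> degree f = d)"
    define s :: multiplicity where "s = (\<chi> i. if i = 2 then b - 1 else t $ i)"
    have "s + axis 2 1 = t"
      using * by (simp add: vec_eq_iff forall_3 s_def ax b_def)
    moreover have "affine_der (d - 1) s f g"
      using * aff' g_exact by (auto simp: affine_der_def s_def a_def b_def c_def)
    ultimately show False
      using no_small[of "d - 1" s 2 f g] nz * g_exact(2) by auto
  qed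
  \<comment> \<open>Dividing by \<open>x\<close> lowers the degree by one and the first entry by at
    most one; for \<open>a = 0\<close> the multiplicity stays \<open>t\<close>.\<close>
  have no_common_x: "\<not> ([:0, 1:] dvd f \<and> [:0, 1:] dvd g)"
  proof
    assume "[:0, 1:] dvd f \<and> [:0, 1:] dvd g"
    then obtain f' g' where f': "f = [:0, 1:] * f'" and g': "g = [:0, 1:] * g'"
      by (auto elim!: dvdE)
    have nz': "f' \<noteq> 0" "g' \<noteq> 0"
      using f_nz g_exact(1) f' g' by auto
    have deg: "degree f = Suc (degree f')" "degree g = Suc (degree g')"
      using nz' by (simp_all add: f' g')
    define s :: multiplicity where "s = (\<chi> i. if i = 1 then a - 1 else t $ i)"
    have "s = t \<or> s + axis 1 1 = t"
      by (cases "a = 0") (simp_all add: vec_eq_iff forall_3 s_def ax a_def)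
    moreover have "[:0, 1:] ^ (a - 1) dvd f'"
      using aff'(3) unfolding f' by (cases a) auto
    moreover have "[:1, 1:] ^ c dvd f' + g'"
      using linear_power_dvd_mult_cancel[of "- 1" c "[:0, 1:]" "f' + g'"] aff'(4)
      by (simp add: f' g' distrib_left)
    ultimately show False
      using no_small[of "d - 1" s 1 f' g'] nz' aff'(1,2) deg g_exact(1)
      by (auto simp: affine_der_def s_def b_def c_def)
  qed
  have no_common_z: "\<not> ([:1, 1:] dvd f \<and> [:1, 1:] dvd g)"
  proof
    assume "[:1, 1:] dvd f \<and> [:1, 1:] dvd g"
    then obtain f' g' where f': "f = [:1, 1:] * f'" and g': "g = [:1, 1:] * g'"
      by (auto elim!: dvdE)
    have nz': "f' \<noteq> 0" "g' \<noteq> 0"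
      using f_nz g_exact(1) f' g' by auto
    have deg: "degree f = Suc (degree f')" "degree g = Suc (degree g')"
      using nz' by (simp_all add: f' g' degree_mult_eq del: mult_pCons_left)
    define s :: multiplicity where "s = (\<chi> i. if i = 3 then c - 1 else t $ i)"
    have "s = t \<or> s + axis 3 1 = t"
      by (cases "c = 0") (simp_all add: vec_eq_iff forall_3 s_def ax c_def)
    moreover have "[:1, 1:] ^ (c - 1) dvd f' + g'"
    proof (cases c)
      case (Suc n)
      have "[:1, 1:] * [:1, 1:] ^ n dvd [:1, 1:] * (f' + g')"
        using aff'(4) unfolding f' g' Suc distrib_left by simp
      then show ?thesis
        using Suc by (simp only: dvd_mult_cancel_left) auto
    qed simp
    moreover have "[:0, 1:] ^ a dvd f'"
      using linear_power_dvd_mult_cancel[of 0 a "[:1, 1:]" f'] aff'(3) by (simp add: f' del: mult_pCons_left)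
    ultimately show False
      using no_small[of "d - 1" s 3 f' g'] nz' aff'(1,2) deg g_exact(1)
      by (auto simp: affine_der_def s_def a_def b_def)
  qed
  \<comment> \<open>A common divisor without the roots 0 and -1 can be divided out without loss in
    either divisibility, which lowers the degree at \<open>t\<close> itself.\<close>
  have coprime: "degree h = 0" if h: "h dvd f" "h dvd g" for h
  proof (rule ccontr)
    assume "degree h \<noteq> 0"
    obtain f' g' where f': "f = h * f'" and g': "g = h * g'"
      using h by (auto elim!: dvdE)
    have nz': "f' \<noteq> 0" "g' \<noteq> 0" "h \<noteq> 0"
      using f_nz g_exact(1) f' g' by auto
    have "poly h 0 \<noteq> 0"
    proof
      assume "poly h 0 = 0"
      then have "[:0, 1:] dvd h"
        using poly_eq_0_iff_dvd[of h 0] by simp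
      then show False
        using no_common_x h dvd_trans by blast
    qed
    moreover have "poly h (- 1) \<noteq> 0"
    proof
      assume "poly h (- 1) = 0"
      then have "[:1, 1:] dvd h"
        using poly_eq_0_iff_dvd[of h "- 1"] by simp
      then show False
        using no_common_z h dvd_trans by blast
    qed
    ultimately have "[:0, 1:] ^ a dvd f'" "[:1, 1:] ^ c dvd f' + g'"
      using linear_power_dvd_mult_cancel[of 0 a h f'] linear_power_dvd_mult_cancel[of "- 1" c h "f' + g'"]
        aff'(3,4) by (simp_all add: f' g' distrib_left)
    moreover have "degree f = degree h + degree f'" "degree g = degree h + degree g'"
      using nz' by (simp_all add: f' g' degree_mult_eq)
    ultimately show False
      using no_small[of "d - 1" t _ f' g'] nz' aff'(1,2) g_exact(1) \<open>degree h \<noteq> 0\<close>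
      by (auto simp: affine_der_def a_def b_def c_def)
  qed
  have "pderiv f * g = f * pderiv g"
  proof (rule ccontr)
    assume *: "pderiv f * g \<noteq> f * pderiv g"
    define w where "w = pderiv f * g - f * pderiv g"
    have w_nz: "w \<noteq> 0"
      using * by (simp add: w_def)
    \<comment> \<open>The Wronskian is unchanged when \<open>g\<close> is replaced by
      \<open>f + g\<close>, so the high power of \<open>x + 1\<close> in \<open>f + g\<close> also
      shows in \<open>w\<close>.\<close>
    have w_alt: "w = pderiv f * (f + g) - f * pderiv (f + g)"
      by (simp add: w_def pderiv_add algebra_simps)
    have "[:0, 1:] ^ (a - 1) dvd f" "[:1, 1:] ^ (c - 1) dvd f + g"
      using aff'(3,4) power_le_dvd diff_le_self by blast+
    then have "[:0, 1:] ^ (a - 1) dvd w" "[:1, 1:] ^ (c - 1) dvd w"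
      using power_dvd_pderiv[OF aff'(3)] power_dvd_pderiv[OF aff'(4)]
      unfolding w_def w_alt[unfolded w_def] by (auto intro!: dvd_diff)
    then have "(a - 1) + (c - 1) \<le> degree w"
      using dvd_imp_degree_le[OF linear_powers_dvd w_nz] unfolding degree_linear_powers by blast
    moreover have "degree w < degree f + degree g"
    proof -
      have "degree (pderiv f * g) < degree f + degree g \<or> pderiv f * g = 0"
        using degree_pderiv_less[of f] degree_mult_le[of "pderiv f" g] by fastforce
      moreover have "degree (f * pderiv g) < degree f + degree g \<or> f * pderiv g = 0"
        using degree_pderiv_less[of g] degree_mult_le[of f "pderiv g"] by fastforce
      ultimately show ?thesis
        using w_nz unfolding w_def by (auto intro: degree_diff_less)
    qed
    \<comment> \<open>The bounds give \<open>a + c - 2 < 2 * d - b\<close>, whereas the gap of at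
      least 2 says \<open>2 * d + 2 \<le> a + b + c\<close>.\<close>
    ultimately show False
      using gap aff'(1) g_exact(2) by (simp add: wt_3 d_def a_def b_def c_def)
  qed
  then have "pderiv f = 0" "pderiv g = 0"
    using wronskian_0_imp_pderiv_0 f_nz coprime by blast+
  then obtain f1 g1 where f1: "f = f1 ^ p" and g1: "g = g1 ^ p"
    using pderiv_0_imp_power[OF char fin] by metis
  have nz1: "f1 \<noteq> 0" "g1 \<noteq> 0"
    using f_nz g_exact(1) f1 g1 p_pos by auto
  have fg1: "f + g = (f1 + g1) ^ p"
    unfolding f1 g1 by (rule freshmans_dream[symmetric]) (simp_all add: char)
  have fg1_nz: "f1 + g1 \<noteq> 0"
    using fg_nz fg1 p_pos by auto
  have order_power: "order r (h ^ n) = n * order r h" if "h \<noteq> 0" for r :: 'a and h n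
    using that by (induction n) (auto simp: order_mult)
  have a: "a = p * order 0 f1"
  proof -
    have "order 0 f = a"
      using aff'(3) f_exact order_divides[of 0 a f] order_divides[of 0 "Suc a" f] f_nz by (simp del: power_Suc)
    then show ?thesis
      by (simp add: f1 order_power nz1)
  qed
  have c: "c = p * order (- 1) (f1 + g1)"
  proof -
    have "order (- 1) (f + g) = c"
      using aff'(4) fg_exact order_divides[of "- 1" c "f + g"] order_divides[of "- 1" "Suc c" "f + g"] fg_nz
      by (simp del: power_Suc)
    then show ?thesis
      by (simp add: fg1 order_power fg1_nz)
  qed
  have deg1: "degree f = p * degree f1" "degree g = p * degree g1"
    using nz1 by (simp_all add: f1 g1 degree_power_eq)
  \<comment> \<open>By \<open>degree_max\<close>, \<open>d\<close> is the degree of \<open>g\<close>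
    if \<open>b = 0\<close> and that of \<open>f\<close> otherwise; both degrees are multiples of
    \<open>p\<close>.\<close>
  have "p dvd d"
    using degree_max g_exact(2) deg1 by (metis add.right_neutral dvd_triv_left)
  then obtain d1 where d1: "d = p * d1" ..
  have b: "b = p * (d1 - degree g1)"
    using g_exact(2) deg1(2) d1 by (simp add: diff_mult_distrib2)
  have "p * degree g1 \<le> p * d1"
    using g_exact(2) deg1(2) d1 by linarith
  then have "degree g1 \<le> d1"
    using p_pos by simp
  define s :: multiplicity where
    "s = (\<chi> i. if i = 1 then order 0 f1 else if i = 2 then d1 - degree g1 else order (- 1) (f1 + g1))"
  have "degree f1 \<le> d1"
    using aff'(1) deg1(1) d1 p_pos by simp
  then have "affine_der d1 s f1 g1"
    using \<open>degree g1 \<le> d1\<close> order_1[of 0 f1] order_1[of "- 1" "f1 + g1"] by (simp add: affine_der_def s_def)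
  then have "mdr F s \<le> d1"
    using mdr_le_affine_der nz1 by blast
  moreover have "t = p *s s"
    using a b c by (simp add: vec_eq_iff forall_3 s_def a_def b_def c_def)
  ultimately show ?thesis
    using d1 by (intro exI[of _ s]) (auto simp: d_def)
qed

section \<open>The exponents of balanced multiplicities\<close>

text \<open>Translation by 1 permutes the field, so the sum of all elements equals itself plus
  \<open>p\<close> times 1.\<close>

lemma CHAR_of_prime_card:
  assumes "prime p" "CARD('a::field) = p"
  shows "CHAR('a) = p"
proof -
  have "(\<Sum>x\<in>UNIV. x) = (\<Sum>x\<in>UNIV. x + 1 :: 'a)"
    by (rule sum.reindex_bij_witness[of _ "\<lambda>x. x + 1" "\<lambda>x. x - 1"]) auto
  then have "of_nat p = (0 :: 'a)"
    using assms(2) by (simp add: sum.distrib)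
  then have "CHAR('a) dvd p"
    by (simp add: of_nat_eq_0_iff_char_dvd)
  then show ?thesis
    using assms(1) CHAR_not_1'[where ?'a = 'a] by (auto simp: prime_nat_iff)
qed

lemma syzygy_gap_Delta:
  fixes F :: "'a::field itself"
  assumes "prime p" "CARD('a) = p"
  shows "syzygy_gap p (Delta F)"
proof
  note char = CHAR_of_prime_card[OF assms]
  have fin: "finite (UNIV :: 'a set)"
    using assms prime_gt_0_nat card_ge_0_finite by metis
  show "p \<ge> 2"
    using assms(1) by (rule prime_ge_2_nat)
  show "even (Delta F t) \<longleftrightarrow> even (wt t)" for t
    by (simp add: Delta_eq)
  show "Delta F t \<ge> 0" for t
    using two_mdr_le[of F t] by (simp add: Delta_eq)
  show "Delta F t \<le> Delta F s + sep s t" for s t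
    using mdr_lipschitz[of F s t] by (simp add: Delta_eq wt_3 sep_3 sum_3)
  show "Delta F t \<le> int (wt t) - 2 * int (t $ i)" if "t \<in> Lambda_bal" for t i
    using mdr_ge_balanced[OF that, of i F] by (simp add: Delta_eq)
  show "int p * Delta F t \<le> Delta F (p *s t)" for t
  proof -
    have "int (mdr F (p *s t)) \<le> int p * int (mdr F t)"
      using mdr_frobenius[OF char assms(1), of F t] by (simp flip: of_nat_mult)
    then show ?thesis
      by (simp add: Delta_eq wt_scale algebra_simps)
  qed
  fix t
  assume peak: "\<And>s. sep s t = 1 \<Longrightarrow> Delta F s < Delta F t" and ge_2: "Delta F t \<ge> 2"
  have sep_axis: "sep s (s + axis i 1) = 1" "sep (s + axis i 1) s = 1" "wt (s + axis i 1) = Suc (wt s)" for s :: multiplicity and i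
    using exhaust_3[of i] by (auto simp: sep_3 wt_3 axis_def)
  \<comment> \<open>A lower gap at a point of weight one more forces a larger minimal degree, while
    at a point of weight one less it only prevents a smaller one.\<close>
  have "mdr F t < mdr F (t + axis i 1)" for i
    using peak[of "t + axis i 1"] sep_axis[of t i] by (simp add: Delta_eq)
  moreover have "mdr F t \<le> mdr F s" if "s + axis i 1 = t" for s i
    using peak[of s] sep_axis[of s i] that by (simp add: Delta_eq)
  moreover have "2 * mdr F t + 2 \<le> wt t"
    using ge_2 by (simp add: Delta_eq)
  ultimately obtain s where s: "t = p *s s" "p * mdr F s \<le> mdr F t"
    using mdr_peak[OF char assms(1) fin, of F t] by blast
  have "Delta F t \<le> int p * Delta F s"
  proof -
    have "int p * int (mdr F s) \<le> int (mdr F t)"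
      using s(2) by (simp flip: of_nat_mult)
    then show ?thesis
      by (simp add: Delta_eq s(1) wt_scale algebra_simps)
  qed
  then show "\<exists>s. t = p *s s \<and> Delta F t \<le> int p * Delta F s"
    using s(1) by blast
qed

text \<open>Here \<open>e\<close> is the smaller exponent; it is the one listed first in each case
  of the theorem.\<close>

lemma exponents_from_Delta:
  assumes "Delta F t = \<delta>" "int (wt t) - \<delta> = 2 * int e" "d + e = wt t"
  shows "exponents F t = {#e, d#}"
proof -
  have "mdr F t = e" "wt t - mdr F t = d"
    using assms by (simp_all add: Delta_eq)
  then show ?thesis
    by (simp add: exponents_eq)
qed

text \<open>Numerals that arise when \<open>i + 1\<close> and \<open>i + 2\<close> are computed for
  \<open>i = 2\<close> and \<open>i = 3\<close>.\<close>

lemma numeral_4_5_mod_3: "(4 :: 3) = 1" "(5 :: 3) = 2"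
  by simp_all

lemma wt_cyclic: "wt t = t $ i + t $ (i + 1) + t $ (i + 2)"
  using exhaust_3[of i] by (auto simp: wt_3 numeral_4_5_mod_3)

lemma sep_cyclic:
  "sep s t = \<bar>int (s $ i) - int (t $ i)\<bar> + \<bar>int (s $ (i + 1)) - int (t $ (i + 1))\<bar> +
     \<bar>int (s $ (i + 2)) - int (t $ (i + 2))\<bar>"
  using exhaust_3[of i] by (auto simp: sep_3 numeral_4_5_mod_3)

theorem theorem3p6:
  fixes p k :: nat and \<mu> :: multiplicity and F :: "'a::field itself"
  assumes "prime p"
    and "CARD('a) = p"
    and "\<mu> \<in> Lambda_bal"
    and "k = kmax p \<mu>"
  shows
    "(k = 0 \<longrightarrow>
       (\<mu> \<in> Lambda_bal_odd \<longrightarrow>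
          Delta F \<mu> = 1 \<and>
          exponents F \<mu> = {# (wt \<mu> - 1) div 2, (wt \<mu> + 1) div 2 #}) \<and>
       (\<mu> \<in> Lambda_bal_even \<longrightarrow>
          Delta F \<mu> = 0 \<and>
          exponents F \<mu> = {# wt \<mu> div 2, wt \<mu> div 2 #})) \<and>
     (k > 0 \<longrightarrow>
       (\<forall>\<alpha> \<beta> :: multiplicity. \<mu> = p ^ k *s \<alpha> + \<beta> \<and> (\<forall>i. \<beta> $ i < p ^ k) \<longrightarrow>
          (\<forall>i. \<alpha> \<in> Lambda_even \<and> real (\<beta> $ i) > real (wt \<beta>) / 2 \<longrightarrow>
             Delta F \<mu> = int (\<beta> $ i) - int (\<beta> $ (i + 1)) - int (\<beta> $ (i + 2)) \<and>
             exponents F \<mu> =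
               {# wt \<alpha> div 2 * p ^ k + \<beta> $ (i + 1) + \<beta> $ (i + 2),
                  wt \<alpha> div 2 * p ^ k + \<beta> $ i #}) \<and>
          (\<alpha> \<in> Lambda_even \<and> real (wt \<beta>) / 2 > real (p ^ k) \<longrightarrow>
             Delta F \<mu> = int (wt \<beta>) - 2 * int (p ^ k) \<and>
             exponents F \<mu> =
               {# wt \<alpha> div 2 * p ^ k + p ^ k,
                  wt \<alpha> div 2 * p ^ k + wt \<beta> - p ^ k #}) \<and>
          (\<forall>i. \<alpha> \<in> Lambda_odd \<and>
               real (p ^ k) - real (\<beta> $ i)
                 > real_of_int (l1 (\<chi> j. int (p ^ k) - int (\<beta> $ j))) / 2 \<longrightarrow>
             Delta F \<mu> =
               - int (\<beta> $ i) + int (\<beta> $ (i + 1)) + int (\<beta> $ (i + 2)) - int (p ^ k) \<and>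
             exponents F \<mu> =
               {# (wt \<alpha> + 1) div 2 * p ^ k + \<beta> $ i,
                  (wt \<alpha> - 1) div 2 * p ^ k + \<beta> $ (i + 1) + \<beta> $ (i + 2) #}) \<and>
          (\<alpha> \<in> Lambda_odd \<and>
             real_of_int (l1 (\<chi> j. int (p ^ k) - int (\<beta> $ j))) / 2 > real (p ^ k) \<longrightarrow>
             Delta F \<mu> = int (p ^ k) - int (wt \<beta>) \<and>
             exponents F \<mu> =
               {# (wt \<alpha> - 1) div 2 * p ^ k + wt \<beta>,
                  (wt \<alpha> + 1) div 2 * p ^ k #})))"
proof (intro conjI impI allI)
  interpret syzygy_gap p "Delta F"
    by (rule syzygy_gap_Delta) fact+
  {
    assume "k = 0"
    \<comment> \<open>A gap of at most 1 is determined by the parity of the weight.\<close>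
    then have le_1: "Delta F \<mu> \<le> 1"
      using gap_le_1 assms by simp
    {
      assume "\<mu> \<in> Lambda_bal_odd"
      then have odd: "odd (wt \<mu>)"
        by (simp add: Lambda_bal_odd_def Lambda_odd_def)
      then show *: "Delta F \<mu> = 1"
        using le_1 gap_nonneg[of \<mu>] even_gap_iff[of \<mu>] by presburger
      show "exponents F \<mu> = {# (wt \<mu> - 1) div 2, (wt \<mu> + 1) div 2 #}"
        using odd by (intro exponents_from_Delta[OF *]) (auto elim!: oddE)
    next
      assume "\<mu> \<in> Lambda_bal_even"
      then have even: "even (wt \<mu>)"
        by (simp add: Lambda_bal_even_def Lambda_even_def)
      then show *: "Delta F \<mu> = 0"
        using le_1 gap_nonneg[of \<mu>] even_gap_iff[of \<mu>] by presburger
      show "exponents F \<mu> = {# wt \<mu> div 2, wt \<mu> div 2 #}"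
        using even by (intro exponents_from_Delta[OF *]) (auto elim!: evenE)
    }
  }
  {
    fix \<alpha> \<beta> :: multiplicity
    assume "k > 0" and \<mu>: "\<mu> = p ^ k *s \<alpha> + \<beta> \<and> (\<forall>i. \<beta> $ i < p ^ k)"
    define q where "q = p ^ k"
    have \<mu>_i: "\<mu> $ i = q * \<alpha> $ i + \<beta> $ i" and \<beta>_less: "\<beta> $ i < q" for i
      using \<mu> by (simp_all add: q_def)
    have wt_\<mu>: "wt \<mu> = q * wt \<alpha> + wt \<beta>"
      by (simp add: wt_3 \<mu>_i algebra_simps)
    have tent: "Delta F \<mu> = int q - sep \<mu> (q *s \<nu>)" if "odd (wt \<nu>)" "sep \<mu> (q *s \<nu>) < int q" for \<nu>
      using gap_eq_tent[OF assms(3,4) that(1)] that(2) unfolding q_def by simp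
    have l1_complement: "l1 (\<chi> j. int (p ^ k) - int (\<beta> $ j)) = 3 * int q - int (wt \<beta>)"
      using \<beta>_less[of 1] \<beta>_less[of 2] \<beta>_less[of 3] by (simp add: l1_def sum_3 wt_3 q_def)
    have abs_less: "\<bar>int (\<beta> $ i) - int q\<bar> = int q - int (\<beta> $ i)" for i
      using \<beta>_less[of i] by simp
    \<comment> \<open>The point \<open>\<mu>\<close> lies in a cube of side \<open>q\<close> with
      lowest corner \<open>q *s \<alpha>\<close>. In each case below, a corner
      \<open>q *s \<nu>\<close> with odd \<open>wt \<nu>\<close> at distance less than
      \<open>q\<close> is the centre of the tent.\<close>
    have sep_shift: "sep \<mu> (q *s (\<alpha> + \<epsilon>)) =
        \<bar>int (\<beta> $ i) - int q * int (\<epsilon> $ i)\<bar> + \<bar>int (\<beta> $ (i + 1)) - int q * int (\<epsilon> $ (i + 1))\<bar> +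
        \<bar>int (\<beta> $ (i + 2)) - int q * int (\<epsilon> $ (i + 2))\<bar>" for \<epsilon> i
      by (simp add: sep_cyclic[of _ _ i] \<mu>_i distrib_left)
    have cyc: "i + 1 \<noteq> i" "i + 2 \<noteq> i" for i :: 3
      using exhaust_3[of i] by auto
    {
      fix i assume c: "\<alpha> \<in> Lambda_even \<and> real (\<beta> $ i) > real (wt \<beta>) / 2"
      then have "even (wt \<alpha>)" "\<beta> $ i > \<beta> $ (i + 1) + \<beta> $ (i + 2)"
        by (auto simp: Lambda_even_def wt_cyclic[of \<beta> i])
      \<comment> \<open>With \<open>\<alpha>\<close> even, a dominant \<open>\<beta> $ i\<close>
        makes the corner one step in direction \<open>i\<close> the close odd one.\<close>
      define \<nu> where "\<nu> = \<alpha> + (\<chi> j. if j = i then 1 else 0)"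
      have "wt \<nu> = Suc (wt \<alpha>)"
        using cyc[of i] by (simp add: wt_cyclic[of _ i] \<nu>_def)
      moreover have sep: "sep \<mu> (q *s \<nu>) = int q - int (\<beta> $ i) + int (\<beta> $ (i + 1)) + int (\<beta> $ (i + 2))"
        unfolding \<nu>_def sep_shift[of _ i] using cyc[of i] by (simp add: abs_less)
      ultimately show *: "Delta F \<mu> = int (\<beta> $ i) - int (\<beta> $ (i + 1)) - int (\<beta> $ (i + 2))"
        using tent[of \<nu>] \<open>even (wt \<alpha>)\<close> \<open>\<beta> $ i > \<beta> $ (i + 1) + \<beta> $ (i + 2)\<close> by simp
      show "exponents F \<mu> =
               {# wt \<alpha> div 2 * p ^ k + \<beta> $ (i + 1) + \<beta> $ (i + 2),
                  wt \<alpha> div 2 * p ^ k + \<beta> $ i #}"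
        using \<open>even (wt \<alpha>)\<close>
        by (intro exponents_from_Delta[OF *])
          (auto simp: wt_\<mu> wt_cyclic[of \<beta> i] q_def algebra_simps elim!: evenE)
    }
    {
      assume d: "\<alpha> \<in> Lambda_even \<and> real (wt \<beta>) / 2 > real (p ^ k)"
      then have "real (2 * q) < real (wt \<beta>)"
        by (simp add: q_def)
      then have d: "even (wt \<alpha>)" "2 * q < wt \<beta>"
        using d unfolding of_nat_less_iff by (auto simp: Lambda_even_def)
      \<comment> \<open>With \<open>\<alpha>\<close> even and \<open>\<beta>\<close> large, the
        close odd corner is the opposite one, all three coordinates being raised.\<close>
      define \<nu> where "\<nu> = \<alpha> + (\<chi> j. 1)"
      have "wt \<nu> = wt \<alpha> + 3"
        by (simp add: wt_3 \<nu>_def)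
      moreover have "sep \<mu> (q *s \<nu>) = 3 * int q - int (wt \<beta>)"
        unfolding \<nu>_def sep_shift[of _ 1] by (simp add: abs_less wt_cyclic[of \<beta> 1])
      ultimately show *: "Delta F \<mu> = int (wt \<beta>) - 2 * int (p ^ k)"
        using tent[of \<nu>] d unfolding q_def[symmetric] by simp
      show "exponents F \<mu> =
               {# wt \<alpha> div 2 * p ^ k + p ^ k, wt \<alpha> div 2 * p ^ k + wt \<beta> - p ^ k #}"
        using d by (intro exponents_from_Delta[OF *]) (auto simp: wt_\<mu> q_def algebra_simps elim!: evenE)
    }
    {
      fix i
      assume e: "\<alpha> \<in> Lambda_odd \<and> real (p ^ k) - real (\<beta> $ i)
                 > real_of_int (l1 (\<chi> j. int (p ^ k) - int (\<beta> $ j))) / 2"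
      then have "real (q + 2 * \<beta> $ i) < real (wt \<beta>)"
        unfolding l1_complement by (simp add: q_def field_simps)
      then have "q + 2 * \<beta> $ i < wt \<beta>"
        by (simp only: of_nat_less_iff)
      then have less: "q + \<beta> $ i < \<beta> $ (i + 1) + \<beta> $ (i + 2)"
        by (simp add: wt_cyclic[of \<beta> i])
      have odd: "odd (wt \<alpha>)"
        using e by (simp add: Lambda_odd_def)
      \<comment> \<open>With \<open>\<alpha>\<close> odd, raising the two coordinates other than
        \<open>i\<close> keeps the weight odd; the condition says that this corner is closer than
        \<open>q\<close>.\<close>
      define \<nu> where "\<nu> = \<alpha> + (\<chi> j. if j = i then 0 else 1)"
      have "wt \<nu> = wt \<alpha> + 2"
        using cyc[of i] by (simp add: wt_cyclic[of _ i] \<nu>_def)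
      moreover have "sep \<mu> (q *s \<nu>) = 2 * int q + int (\<beta> $ i) - int (\<beta> $ (i + 1)) - int (\<beta> $ (i + 2))"
        unfolding \<nu>_def sep_shift[of _ i] using cyc[of i] by (simp add: abs_less)
      ultimately show *: "Delta F \<mu> =
               - int (\<beta> $ i) + int (\<beta> $ (i + 1)) + int (\<beta> $ (i + 2)) - int (p ^ k)"
        using tent[of \<nu>] odd less unfolding q_def[symmetric] by simp
      show "exponents F \<mu> =
               {# (wt \<alpha> + 1) div 2 * p ^ k + \<beta> $ i,
                  (wt \<alpha> - 1) div 2 * p ^ k + \<beta> $ (i + 1) + \<beta> $ (i + 2) #}"
        using odd
        by (intro exponents_from_Delta[OF *])
          (auto simp: wt_\<mu> wt_cyclic[of \<beta> i] q_def algebra_simps elim!: oddE)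
    }
    {
      assume f: "\<alpha> \<in> Lambda_odd \<and>
        real_of_int (l1 (\<chi> j. int (p ^ k) - int (\<beta> $ j))) / 2 > real (p ^ k)"
      then have "real (wt \<beta>) < real q"
        unfolding l1_complement by (simp add: q_def)
      then have f: "odd (wt \<alpha>)" "wt \<beta> < q"
        using f by (simp_all add: Lambda_odd_def)
      \<comment> \<open>The condition amounts to \<open>wt \<beta> < q\<close>, so the lowest
        corner, which is odd, serves as the centre.\<close>
      have "sep \<mu> (q *s \<alpha>) = int (wt \<beta>)"
        by (simp add: sep_3 wt_3 \<mu>_i)
      then show *: "Delta F \<mu> = int (p ^ k) - int (wt \<beta>)"
        using tent[of \<alpha>] f unfolding q_def[symmetric] by simp
      show "exponents F \<mu> =
               {# (wt \<alpha> - 1) div 2 * p ^ k + wt \<beta>, (wt \<alpha> + 1) div 2 * p ^ k #}"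
        using f by (intro exponents_from_Delta[OF *]) (auto simp: wt_\<mu> q_def algebra_simps elim!: oddE)
    }
  }
qed

end
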